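(* Let $T_1,\dots,T_d$ be commuting unitary operators on a Hilbert space $\mathcal H$ such that the unitary representation $\underline\ell\mapsto T^{\underline\ell}=T_1^{\ell_1}\cdots T_d^{\ell_d}$ of $\mathbb{Z}^d$ has the Lebesgue spectrum property. Let $(p_1,\dots,p_d)$ be a probability vector with $p_j>0$ for all $j$, and for $\theta=(\theta_1,\dots,\theta_d)\in\mathbb{T}^d$ let $$P_\theta f=\sum_{j=1}^d p_j\,e^{2\pi i\theta_j}\,T_jf .$$ Let $f\in\mathcal H$. If the spectral density $\varphi_f$ of $f$ is continuous, then for every $\theta\in\mathbb{T}^d$ $$\lim_{n\to\infty}(4\pi)^{\frac{d-1}{2}}(p_1\cdots p_d)^{\frac12}\,n^{\frac{d-1}{2}}\,\|P_\theta^nf\|^2=\int_{\mathbb{T}}\varphi_f(\theta_1+u,\dots,\theta_d+u)\,du.$$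
   Context: $\mathbb{T}^d=\mathbb{R}^d/\mathbb{Z}^d$. Lebesgue spectrum property: there is a closed subspace $\mathcal K_0\subset\mathcal H$ such that the subspaces $T^{\underline\ell}\mathcal K_0$, $\underline\ell\in\mathbb{Z}^d$, are pairwise orthogonal and span a dense subspace of $\mathcal H$. Then for every $f\in\mathcal H$ there is a function $\varphi_f\in L^1(\mathbb{T}^d)$, $\varphi_f\ge0$, the spectral density of $f$, with $\int_{\mathbb{T}^d}\varphi_f(t)e^{-2\pi i\langle\underline\ell,t\rangle}dt=\langle T^{\underline\ell}f,f\rangle$ for all $\underline\ell\in\mathbb{Z}^d$. *)

theory Defs
  imports "HOL-Analysis.Analysis"
begin

text \<open>The inner product is linear in its first argument; this convention matters, because the
  sign in the exponent defining the spectral density depends on it.\<close>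

class complex_hilbert_space = banach +
  fixes scaleC :: "complex \<Rightarrow> 'a \<Rightarrow> 'a"  (infixr \<open>*\<^sub>C\<close> 75)
    and cinner :: "'a \<Rightarrow> 'a \<Rightarrow> complex"
  assumes scaleR_scaleC: "r *\<^sub>R x = complex_of_real r *\<^sub>C x"
    and scaleC_add_right: "a *\<^sub>C (x + y) = a *\<^sub>C x + a *\<^sub>C y"
    and scaleC_add_left: "(a + b) *\<^sub>C x = a *\<^sub>C x + b *\<^sub>C x"
    and scaleC_scaleC: "a *\<^sub>C b *\<^sub>C x = (a * b) *\<^sub>C x"
    and cinner_commute: "cinner x y = cnj (cinner y x)"
    and cinner_add_left: "cinner (x + y) z = cinner x z + cinner y z"
    and cinner_scaleC_left: "cinner (a *\<^sub>C x) y = a * cinner x y"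
    and cinner_self: "cinner x x = complex_of_real ((norm x)\<^sup>2)"

lemma vector_space_scaleC:
  "vector_space (scaleC :: complex \<Rightarrow> 'a \<Rightarrow> 'a::complex_hilbert_space)"
proof
  fix x :: 'a
  show "1 *\<^sub>C x = x"
    using scaleR_scaleC[of 1 x] by simp
qed (rule scaleC_add_right scaleC_add_left scaleC_scaleC)+

instantiation complex :: complex_hilbert_space
begin

definition scaleC_complex :: "complex \<Rightarrow> complex \<Rightarrow> complex"
  where "scaleC_complex = (*)"

definition cinner_complex :: "complex \<Rightarrow> complex \<Rightarrow> complex"
  where "cinner_complex x y = x * cnj y"

instance
  by standard
    (auto simp: scaleC_complex_def cinner_complex_def scaleR_conv_of_real algebra_simps
      simp flip: complex_norm_square)

end

definition unitary :: "('h::complex_hilbert_space \<Rightarrow> 'h) \<Rightarrow> bool" where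
  "unitary U \<longleftrightarrow> Vector_Spaces.linear scaleC scaleC U \<and> surj U \<and>
     (\<forall>x y. cinner (U x) (U y) = cinner x y)"

definition int_funpow :: "('a \<Rightarrow> 'a) \<Rightarrow> int \<Rightarrow> 'a \<Rightarrow> 'a" where
  "int_funpow U k = (if k \<ge> 0 then U ^^ nat k else inv U ^^ nat (- k))"

text \<open>The composition over all \<open>j\<close> of the powers \<open>T j\<close> to the \<open>l $ j\<close>. The index type is
  unordered; the value is independent of the order of composition when the \<open>T j\<close> are
  commuting bijections, the only case of interest.\<close>

definition lattice_power :: "('d::finite \<Rightarrow> 'h \<Rightarrow> 'h) \<Rightarrow> int ^ 'd \<Rightarrow> 'h \<Rightarrow> 'h" where
  "lattice_power T l = Finite_Set.fold (\<lambda>j g. int_funpow (T j) (l $ j) \<circ> g) id UNIV"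

definition lebesgue_spectrum ::
    "('d::finite \<Rightarrow> 'h \<Rightarrow> 'h::complex_hilbert_space) \<Rightarrow> bool" where
  "lebesgue_spectrum T \<longleftrightarrow>
     (\<exists>K. module.subspace scaleC K \<and> closed K \<and>
        (\<forall>l m. l \<noteq> m \<longrightarrow>
           (\<forall>x \<in> lattice_power T l ` K. \<forall>y \<in> lattice_power T m ` K. cinner x y = 0)) \<and>
        closure (module.span scaleC (\<Union>l. lattice_power T l ` K)) = UNIV)"

text \<open>Functions on the torus are represented by functions on \<open>\<real>\<^sup>d\<close> that are periodic in every
  coordinate direction; integration over the torus is integration over the unit cube, and
  continuity on the torus is continuity on the whole of \<open>\<real>\<^sup>d\<close>.\<close>

definition torus_fun :: "(real ^ 'd::finite \<Rightarrow> 'a) \<Rightarrow> bool" where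
  "torus_fun \<phi> \<longleftrightarrow> (\<forall>t j. \<phi> (t + axis j 1) = \<phi> t)"

text \<open>The spectral density is an element of \<open>L\<^sup>1\<close>, hence determined only almost everywhere. The
  predicate says that \<open>\<phi>\<close> is a representative of the spectral density of \<open>f\<close>.\<close>

definition is_spectral_density ::
    "('d::finite \<Rightarrow> 'h \<Rightarrow> 'h::complex_hilbert_space) \<Rightarrow> 'h \<Rightarrow> (real ^ 'd \<Rightarrow> real) \<Rightarrow> bool" where
  "is_spectral_density T f \<phi> \<longleftrightarrow>
     torus_fun \<phi> \<and>
     set_integrable lebesgue (cbox 0 1) \<phi> \<and>
     (AE t in lebesgue. 0 \<le> \<phi> t) \<and>
     (\<forall>l. (LINT t:cbox 0 1|lebesgue.
             complex_of_real (\<phi> t) * cis (- 2 * pi * (\<Sum>j\<in>UNIV. real_of_int (l $ j) * t $ j)))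
           = cinner (lattice_power T l f) f)"

definition twisted_average ::
    "('d::finite \<Rightarrow> 'h \<Rightarrow> 'h::complex_hilbert_space) \<Rightarrow> real ^ 'd \<Rightarrow> real ^ 'd \<Rightarrow> 'h \<Rightarrow> 'h" where
  "twisted_average T p \<theta> f =
     (\<Sum>j\<in>UNIV. (complex_of_real (p $ j) * cis (2 * pi * \<theta> $ j)) *\<^sub>C T j f)"

end

theory Submission
  imports Defs "HOL-Probability.Distributions" "HOL-Real_Asymp.Real_Asymp"
begin

text \<open>The cyclic subspace generated by \<open>f\<close> is isometric to the \<open>L\<^sup>2\<close> space of \<open>\<phi>(t) dt\<close> in
  such a way that \<open>f\<close> corresponds to the constant \<open>1\<close> and \<open>T j\<close> to multiplication by
  \<open>cis (- 2 * pi * t $ j)\<close>. The twisted average is then multiplication by its symbol \<open>m(t) = (\<Sum>j. p $ j * cis (2 * pi * (\<theta> $ j - t $ j)))\<close>. Hence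
  \<open>A n = (norm (P\<^sub>\<theta>\<^sup>n f))\<^sup>2\<close> is the integral of \<open>\<phi>(t) * |m(t)|\<^sup>2\<^sup>n\<close> over the torus
  (\<open>twisted_average_power_norm_has_integral\<close>). As \<open>n\<close> grows, \<open>|m|\<^sup>2\<^sup>n\<close> concentrates on the diagonal
  circle through \<open>\<theta>\<close>, where \<open>|m| = 1\<close>, like a Gaussian in the \<open>d - 1\<close> transversal directions.
  Evaluating that Gaussian directly would need coordinates transversal to the diagonal and a
  determinant.

  Both are avoided by averaging over \<open>n\<close>. With weight the square of the Poisson probability of \<open>n\<close>
  for the mean \<open>s\<close>, Parseval's identity for \<open>exp (s * (m * cis (2 * pi * u) - 1))\<close> as a function
  of \<open>u\<close> turns \<open>\<Sum>n. squared_poisson s n * |m|\<^sup>2\<^sup>n\<close> into the average over diagonal translates of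
  \<open>exp (- 4 * s * (\<Sum>j. p $ j * (sin (pi * x $ j))\<^sup>2))\<close>, a product over all \<open>d\<close> coordinates. After
  the translations are moved onto \<open>\<phi>\<close>, the weighted sum of the \<open>A n\<close> is the integral of
  this kernel against the diagonal average of \<open>\<phi>\<close> (\<open>squared_poisson_sums_symbol_powers\<close>).
  The kernel concentrates at a single point, so Laplace's method in \<open>d\<close> dimensions with a diagonal
  quadratic form gives the asymptotics of the weighted sum as \<open>s\<close> tends to infinity
  (\<open>laplace_torus_gaussian\<close>). The total weight is the case \<open>d = 1\<close>.

  The average can be undone because the twisted average is a contraction, so that \<open>A\<close> decreases,
  and because the weights live near \<open>n = s\<close> up to exponentially small tails. This is the
  Tauberian theorem \<open>squared_poisson_tauberian\<close>; dividing by the total weight, of order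
  \<open>1 / sqrt (4 * pi * s)\<close>, lowers the exponent from \<open>d / 2\<close> to \<open>(d - 1) / 2\<close>.\<close>

section \<open>Unitary operators and lattice powers\<close>

lemma cinner_add_right: "cinner x (y + z) = cinner x y + cinner x (z :: 'h::complex_hilbert_space)"
  by (metis cinner_add_left cinner_commute complex_cnj_add)

lemma cinner_scaleC_right: "cinner x (a *\<^sub>C y) = cnj a * cinner x (y :: 'h::complex_hilbert_space)"
  by (metis cinner_scaleC_left cinner_commute complex_cnj_mult)

lemma cinner_zero_left: "cinner 0 (y :: 'h::complex_hilbert_space) = 0"
  using cinner_add_left[of 0 0 y] by simp

lemma cinner_zero_right: "cinner (y :: 'h::complex_hilbert_space) 0 = 0"
  using cinner_add_right[of y 0 0] by simp

lemma cinner_sum_left: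
  "cinner (\<Sum>i\<in>I. x i) (y :: 'h::complex_hilbert_space) = (\<Sum>i\<in>I. cinner (x i) y)"
  by (induction I rule: infinite_finite_induct) (auto simp: cinner_zero_left cinner_add_left)

lemma cinner_sum_right:
  "cinner (y :: 'h::complex_hilbert_space) (\<Sum>i\<in>I. x i) = (\<Sum>i\<in>I. cinner y (x i))"
  by (induction I rule: infinite_finite_induct) (auto simp: cinner_zero_right cinner_add_right)

lemma norm_scaleC: "norm (a *\<^sub>C x) = cmod a * norm (x :: 'h::complex_hilbert_space)"
proof -
  have "complex_of_real ((norm (a *\<^sub>C x))\<^sup>2) = a * cnj a * complex_of_real ((norm x)\<^sup>2)"
    by (simp add: cinner_self[symmetric] cinner_scaleC_left cinner_scaleC_right mult.assoc del: of_real_power)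
  also have "\<dots> = complex_of_real ((cmod a * norm x)\<^sup>2)"
    by (simp add: complex_norm_square[symmetric] power_mult_distrib del: of_real_power)
  finally have "(norm (a *\<^sub>C x))\<^sup>2 = (cmod a * norm x)\<^sup>2"
    using of_real_eq_iff by blast
  then show ?thesis
    by (simp add: power2_eq_iff_nonneg)
qed

lemma unitary_norm:
  assumes "unitary U" shows "norm (U x) = norm x"
proof -
  have "complex_of_real ((norm (U x))\<^sup>2) = complex_of_real ((norm x)\<^sup>2)"
    using assms by (simp add: unitary_def cinner_self[symmetric] del: of_real_power)
  then have "(norm (U x))\<^sup>2 = (norm x)\<^sup>2"
    using of_real_eq_iff by blast
  then show ?thesis
    by (simp add: power2_eq_iff_nonneg)
qed

lemma linear_scaleC_iff:
  fixes U :: "'h::complex_hilbert_space \<Rightarrow> 'h"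
  shows "Vector_Spaces.linear scaleC scaleC U \<longleftrightarrow>
    (\<forall>x y. U (x + y) = U x + U y) \<and> (\<forall>a x. U (a *\<^sub>C x) = a *\<^sub>C U x)"
  using vector_space_scaleC by (auto simp: Vector_Spaces.linear_iff)

lemma unitary_additive: "unitary U \<Longrightarrow> U (x + y) = U x + U y"
  and unitary_scaleC: "unitary U \<Longrightarrow> U (a *\<^sub>C x) = a *\<^sub>C U x"
  and unitary_cinner: "unitary U \<Longrightarrow> cinner (U x) (U y) = cinner x y"
  by (auto simp: unitary_def linear_scaleC_iff)

lemma unitary_bij:
  assumes "unitary U" shows "bij U"
proof (rule bijI)
  show "inj U"
  proof (rule injI)
    fix x y assume "U x = U y"
    then have "U (x - y) = 0"
      using unitary_additive[OF assms, of "x - y" y] by simp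
    then show "x = y"
      using unitary_norm[OF assms, of "x - y"] by simp
  qed
  show "surj U" using assms by (simp add: unitary_def)
qed

lemma unitary_sum:
  assumes "unitary U" shows "U (\<Sum>i\<in>I. x i) = (\<Sum>i\<in>I. U (x i))"
proof -
  have "U 0 = 0" using unitary_norm[OF assms, of 0] by simp
  then show ?thesis
    by (induction I rule: infinite_finite_induct) (auto simp: unitary_additive[OF assms])
qed

lemma unitary_id: "unitary id"
  by (simp add: unitary_def linear_scaleC_iff)

lemma unitary_comp: "unitary U \<Longrightarrow> unitary V \<Longrightarrow> unitary (U \<circ> V)"
  unfolding unitary_def linear_scaleC_iff by (auto simp: comp_surj[unfolded comp_def])

lemma unitary_inv:
  assumes U: "unitary U" shows "unitary (inv U)"
proof -
  have b: "bij U" by (rule unitary_bij[OF U])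
  have s: "U (inv U x) = x" for x
    using b by (simp add: bij_is_surj surj_f_inv_f)
  have i: "inv U (U x) = x" for x
    using b by (simp add: bij_is_inj)
  have "inv U (x + y) = inv U x + inv U y" for x y
    using i[of "inv U x + inv U y"] by (simp add: unitary_additive[OF U] s)
  moreover have "inv U (a *\<^sub>C x) = a *\<^sub>C inv U x" for a x
    using i[of "a *\<^sub>C inv U x"] by (simp add: unitary_scaleC[OF U] s)
  moreover have "cinner (inv U x) (inv U y) = cinner x y" for x y
    using unitary_cinner[OF U, of "inv U x" "inv U y"] by (simp add: s)
  moreover have "surj (inv U)" using b by (simp add: bij_is_inj inj_imp_surj_inv)
  ultimately show ?thesis by (simp add: unitary_def linear_scaleC_iff)
qed

lemma unitary_int_funpow:
  assumes "unitary U" shows "unitary (int_funpow U k)"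
proof -
  have "unitary (V ^^ n)" if "unitary V" for V :: "'a \<Rightarrow> 'a" and n
    using that by (induction n) (auto simp: unitary_id unitary_comp)
  then show ?thesis
    using assms unitary_inv[OF assms] by (simp add: int_funpow_def)
qed

lemma int_funpow_add_one:
  assumes "bij U" shows "int_funpow U (k + 1) = U \<circ> int_funpow U k"
proof (cases "k \<ge> 0")
  case True
  then show ?thesis by (simp add: int_funpow_def nat_add_distrib)
next
  case False
  then have n: "nat (- k) = Suc (nat (- (k + 1)))" by simp
  have "U \<circ> int_funpow U k = inv U ^^ nat (- (k + 1))"
    using False assms unfolding int_funpow_def n
    by (auto simp: fun_eq_iff bij_is_surj surj_f_inv_f)
  also have "\<dots> = int_funpow U (k + 1)"
    using False by (cases "k = -1") (auto simp: int_funpow_def)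
  finally show ?thesis by simp
qed

lemma comp_commute_funpow:
  "f \<circ> g = g \<circ> f \<Longrightarrow> f ^^ n \<circ> g = g \<circ> f ^^ n"
  by (induction n) (auto simp: fun_eq_iff)

lemma comp_commute_inv:
  assumes "bij f" "f \<circ> g = g \<circ> f" shows "inv f \<circ> g = g \<circ> inv f"
proof
  fix x
  have "inv f (g x) = inv f (g (f (inv f x)))"
    using assms(1) by (simp add: bij_is_surj surj_f_inv_f)
  also have "\<dots> = inv f (f (g (inv f x)))" using assms(2) by (metis comp_apply)
  also have "\<dots> = g (inv f x)" using assms(1) by (simp add: bij_is_inj)
  finally show "(inv f \<circ> g) x = (g \<circ> inv f) x" by simp
qed

lemma comp_commute_int_funpow:
  assumes "bij f" "f \<circ> g = g \<circ> f" shows "int_funpow f k \<circ> g = g \<circ> int_funpow f k"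
  using comp_commute_funpow comp_commute_inv assms by (metis int_funpow_def)

context
  fixes T :: "'d::finite \<Rightarrow> 'h::complex_hilbert_space \<Rightarrow> 'h"
  assumes unitary: "\<And>j. unitary (T j)" and commute: "\<And>i j. T i \<circ> T j = T j \<circ> T i"
begin

lemma int_funpow_commute:
  "int_funpow (T i) a \<circ> int_funpow (T j) b = int_funpow (T j) b \<circ> int_funpow (T i) a"
  by (intro comp_commute_int_funpow unitary_bij unitary)
    (rule comp_commute_int_funpow[OF unitary_bij[OF unitary] commute, symmetric])

lemma comp_fun_commute_int_funpow: "comp_fun_commute (\<lambda>j g. int_funpow (T j) (l j) \<circ> g)"
proof
  fix i j
  have "int_funpow (T j) (l j) (int_funpow (T i) (l i) x) =
      int_funpow (T i) (l i) (int_funpow (T j) (l j) x)" for x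
    using int_funpow_commute[of j "l j" i "l i"] by (simp add: fun_eq_iff)
  then show "(\<lambda>g. int_funpow (T j) (l j) \<circ> g) \<circ> (\<lambda>g. int_funpow (T i) (l i) \<circ> g) =
      (\<lambda>g. int_funpow (T i) (l i) \<circ> g) \<circ> (\<lambda>g. int_funpow (T j) (l j) \<circ> g)"
    by (simp add: fun_eq_iff)
qed

text \<open>A property that composition preserves passes to lattice powers one factor at a time; the rule
  hides the fold and its commutation side condition.\<close>

lemma lattice_power_induct:
  assumes "P id" "\<And>j g. P g \<Longrightarrow> P (int_funpow (T j) (l $ j) \<circ> g)"
  shows "P (lattice_power T l)"
proof -
  interpret comp_fun_commute "\<lambda>j g. int_funpow (T j) (l $ j) \<circ> g"
    by (rule comp_fun_commute_int_funpow)
  have "P (Finite_Set.fold (\<lambda>j g. int_funpow (T j) (l $ j) \<circ> g) id A)" if "finite A" for A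
    using that
  proof (induction A rule: finite_induct)
    case empty
    show ?case unfolding fold_empty by (rule assms)
  next
    case (insert j A)
    show ?case
      unfolding fold_insert[OF insert(1,2)] by (rule assms(2)[OF insert(3)])
  qed
  then show ?thesis by (simp add: lattice_power_def)
qed

lemma unitary_lattice_power: "unitary (lattice_power T l)"
  by (rule lattice_power_induct) (intro unitary_id unitary_comp unitary_int_funpow unitary)+

lemma lattice_power_zero: "lattice_power T 0 = id"
  by (rule lattice_power_induct) (simp_all add: int_funpow_def)

lemma lattice_power_add_axis: "lattice_power T (l + axis j 1) = T j \<circ> lattice_power T l"
proof -
  let ?F = "\<lambda>l :: int^'d. \<lambda>j g. int_funpow (T j) (l $ j) \<circ> g"
  interpret A: comp_fun_commute "?F m" for m
    by (rule comp_fun_commute_int_funpow)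
  have rest: "Finite_Set.fold (?F (l + axis j 1)) id (UNIV - {j})
      = Finite_Set.fold (?F l) id (UNIV - {j})"
    by (rule Finite_Set.fold_cong[where S = UNIV, OF A.comp_fun_commute_on_axioms A.comp_fun_commute_on_axioms])
      (auto simp: axis_def)
  have split_off: "lattice_power T m = int_funpow (T j) (m $ j) \<circ> Finite_Set.fold (?F m) id (UNIV - {j})" for m
    unfolding lattice_power_def by (rule A.fold_rec[OF finite UNIV_I])
  have "int_funpow (T j) ((l + axis j 1) $ j) = T j \<circ> int_funpow (T j) (l $ j)"
    by (simp add: int_funpow_add_one unitary_bij unitary)
  then show ?thesis
    by (simp only: split_off rest comp_assoc)
qed

lemma lattice_power_commute: "lattice_power T l \<circ> T j = T j \<circ> lattice_power T l"
proof (rule lattice_power_induct)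
  fix i g assume "g \<circ> T j = T j \<circ> g"
  moreover have "int_funpow (T i) (l $ i) \<circ> T j = T j \<circ> int_funpow (T i) (l $ i)"
    by (rule comp_commute_int_funpow[OF unitary_bij[OF unitary] commute])
  ultimately show "int_funpow (T i) (l $ i) \<circ> g \<circ> T j = T j \<circ> (int_funpow (T i) (l $ i) \<circ> g)"
    by (metis comp_assoc)
qed simp

text \<open>Unitarity of \<open>T k\<close> moves it across the inner product, so only lattice
  powers applied to a single vector remain.\<close>

lemma cinner_lattice_power_shift:
  "cinner (lattice_power T l (T j x)) (T k y) =
   cinner (lattice_power T (l + axis j 1 - axis k 1) x) y"
proof -
  let ?l = "l + axis j 1 - axis k 1"
  have "lattice_power T l (T j x) = lattice_power T (l + axis j 1) x"
    using lattice_power_commute lattice_power_add_axis by (metis comp_apply)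
  also have "l + axis j 1 = ?l + axis k 1" by simp
  also have "lattice_power T (?l + axis k 1) x = T k (lattice_power T ?l x)"
    unfolding lattice_power_add_axis by simp
  finally show ?thesis
    using unitary_cinner[OF unitary] by metis
qed

end

section \<open>Spectral densities of twisted averages\<close>

text \<open>The multiplier by which the twisted average acts when \<open>T j\<close> acts as multiplication by
  \<open>cis (- 2 * pi * t $ j)\<close>.\<close>

definition average_symbol :: "real ^ 'd \<Rightarrow> real ^ 'd \<Rightarrow> real ^ 'd \<Rightarrow> complex" where
  "average_symbol p \<theta> t = (\<Sum>j\<in>UNIV. complex_of_real (p $ j) * cis (2 * pi * (\<theta> $ j - t $ j)))"

definition character :: "int ^ 'd::finite \<Rightarrow> real ^ 'd \<Rightarrow> complex" where
  "character l t = cis (- 2 * pi * (\<Sum>j\<in>UNIV. real_of_int (l $ j) * t $ j))"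

lemma character_shift:
  "character (l + axis j 1 - axis k 1) t = character l t * cis (- 2 * pi * t $ j) * cis (2 * pi * t $ k)"
proof -
  have "(\<Sum>i\<in>UNIV. real_of_int ((l + axis j 1 - axis k 1) $ i) * t $ i)
     = (\<Sum>i\<in>UNIV. real_of_int (l $ i) * t $ i) + t $ j - t $ k"
    by (simp add: axis_def distrib_right left_diff_distrib sum.distrib sum_subtractf
        if_distrib[of real_of_int] if_distrib[of "\<lambda>x. x * _"] cong: if_cong)
  then show ?thesis
    by (simp only: character_def cis_mult) (simp add: algebra_simps)
qed

lemma character_zero [simp]: "character 0 t = 1"
  by (simp add: character_def)

text \<open>Expanding both arguments of \<open>cinner (lattice_power T l (P g)) (P g)\<close>
  gives the correlations of \<open>g\<close> at the lattice points \<open>l + axis j 1 - axis k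
  1\<close>; on the side of the integrals the same double sum is the expansion of the squared
  modulus of the symbol. The statement is about a density in the sense of Fourier coefficients
  only, so it can be iterated.\<close>

lemma twisted_average_has_density:
  fixes T :: "'d::finite \<Rightarrow> 'h::complex_hilbert_space \<Rightarrow> 'h"
  assumes unitary: "\<And>j. unitary (T j)" and commute: "\<And>i j. T i \<circ> T j = T j \<circ> T i"
    and g: "\<And>l. ((\<lambda>t. complex_of_real (\<psi> t) * character l t) has_integral cinner (lattice_power T l g) g) S"
  shows "((\<lambda>t. complex_of_real (\<psi> t * (cmod (average_symbol p \<theta> t))\<^sup>2) * character l t) has_integral
     cinner (lattice_power T l (twisted_average T p \<theta> g)) (twisted_average T p \<theta> g)) S"
proof -
  define c where "c j = complex_of_real (p $ j) * cis (2 * pi * \<theta> $ j)" for j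
  have avg: "twisted_average T p \<theta> g = (\<Sum>j\<in>UNIV. c j *\<^sub>C T j g)"
    by (simp add: twisted_average_def c_def)
  have lp: "unitary (lattice_power T l)"
    by (rule unitary_lattice_power[OF unitary commute])
  have symb: "average_symbol p \<theta> t = (\<Sum>j\<in>UNIV. c j * cis (- 2 * pi * t $ j))" for t
    by (simp add: average_symbol_def c_def cis_mult mult.assoc algebra_simps)
  have "cinner (lattice_power T l (twisted_average T p \<theta> g)) (twisted_average T p \<theta> g)
    = (\<Sum>j\<in>UNIV. \<Sum>k\<in>UNIV. c j * cnj (c k) * cinner (lattice_power T (l + axis j 1 - axis k 1) g) g)"
    unfolding avg unitary_sum[OF lp] unitary_scaleC[OF lp] cinner_sum_left
    unfolding cinner_sum_right cinner_scaleC_left cinner_scaleC_right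
      cinner_lattice_power_shift[of T, OF unitary commute]
    by (simp only: mult_ac)
  moreover have "complex_of_real (\<psi> t * (cmod (average_symbol p \<theta> t))\<^sup>2) * character l t
    = (\<Sum>j\<in>UNIV. \<Sum>k\<in>UNIV. c j * cnj (c k) * (complex_of_real (\<psi> t) * character (l + axis j 1 - axis k 1) t))" for t
  proof -
    have "complex_of_real ((cmod (average_symbol p \<theta> t))\<^sup>2)
      = (\<Sum>j\<in>UNIV. \<Sum>k\<in>UNIV. (c j * cis (- 2 * pi * t $ j)) * cnj (c k * cis (- 2 * pi * t $ k)))"
      unfolding complex_norm_square symb cnj_sum by (rule sum_product)
    then show ?thesis
      by (simp add: character_shift sum_distrib_left sum_distrib_right cis_cnj mult_ac)
  qed
  ultimately show ?thesis
    by (simp only:) (intro has_integral_sum has_integral_mult_right g finite)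
qed

lemma twisted_average_power_norm_has_integral:
  fixes T :: "'d::finite \<Rightarrow> 'h::complex_hilbert_space \<Rightarrow> 'h"
  assumes unitary: "\<And>j. unitary (T j)" and commute: "\<And>i j. T i \<circ> T j = T j \<circ> T i"
    and f: "\<And>l. ((\<lambda>t. complex_of_real (\<psi> t) * character l t) has_integral cinner (lattice_power T l f) f) S"
  shows "((\<lambda>t. \<psi> t * (cmod (average_symbol p \<theta> t)) ^ (2 * n)) has_integral
     (norm ((twisted_average T p \<theta> ^^ n) f))\<^sup>2) S"
proof -
  let ?g = "(twisted_average T p \<theta> ^^ n) f"
  have "((\<lambda>t. complex_of_real (\<psi> t * (cmod (average_symbol p \<theta> t)) ^ (2 * n)) * character l t) has_integral
     cinner (lattice_power T l ((twisted_average T p \<theta> ^^ n) f)) ((twisted_average T p \<theta> ^^ n) f)) S" for l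
  proof (induction n arbitrary: l)
    case (Suc n)
    show ?case
      using twisted_average_has_density[OF unitary commute Suc]
      by (simp add: power2_eq_square mult_ac)
  qed (use f in simp)
  from this[of 0] have "((\<lambda>t. complex_of_real (\<psi> t * (cmod (average_symbol p \<theta> t)) ^ (2 * n))) has_integral
     complex_of_real ((norm ?g)\<^sup>2)) S"
    by (simp add: lattice_power_zero[OF unitary commute] cinner_self)
  from has_integral_Re[OF this] show ?thesis by simp
qed

lemma norm_twisted_average_le:
  fixes T :: "'d::finite \<Rightarrow> 'h::complex_hilbert_space \<Rightarrow> 'h"
  assumes unitary: "\<And>j. unitary (T j)" and p: "\<And>j. 0 \<le> p $ j" "(\<Sum>j\<in>UNIV. p $ j) = 1"
  shows "norm (twisted_average T p \<theta> g) \<le> norm g"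
proof -
  have "norm (twisted_average T p \<theta> g) \<le> (\<Sum>j\<in>UNIV. p $ j * norm g)"
    unfolding twisted_average_def
    by (rule sum_norm_le) (simp add: norm_scaleC norm_mult unitary_norm[OF unitary] p)
  then show ?thesis by (simp add: sum_distrib_right[symmetric] p)
qed

section \<open>Parseval's identity and squared Poisson weights\<close>

lemma integral_sums:
  fixes f :: "nat \<Rightarrow> 'a::euclidean_space \<Rightarrow> 'b::banach"
  assumes cont: "\<And>n. continuous_on (cbox a b) (f n)"
    and bound: "\<And>n x. x \<in> cbox a b \<Longrightarrow> norm (f n x) \<le> M n" and M: "summable M"
  shows "(\<lambda>n. integral (cbox a b) (f n)) sums integral (cbox a b) (\<lambda>x. \<Sum>n. f n x)"
proof -
  have u: "uniform_limit (cbox a b) (\<lambda>n x. \<Sum>i<n. f i x) (\<lambda>x. \<Sum>i. f i x) sequentially"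
    by (rule Weierstrass_m_test[OF bound M])
  have c: "continuous_on (cbox a b) (\<lambda>x. \<Sum>i<n. f i x)" for n
    by (intro continuous_on_sum cont)
  obtain I J where I: "\<And>n. ((\<lambda>x. \<Sum>i<n. f i x) has_integral I n) (cbox a b)"
    and J: "((\<lambda>x. \<Sum>i. f i x) has_integral J) (cbox a b)" and lim: "I \<longlonglongrightarrow> J"
    using uniform_limit_integral_cbox[OF u c sequentially_bot] by blast
  have "((\<lambda>x. \<Sum>i<n. f i x) has_integral (\<Sum>i<n. integral (cbox a b) (f i))) (cbox a b)" for n
    by (intro has_integral_sum integrable_integral integrable_continuous cont) simp
  then have "I = (\<lambda>n. \<Sum>i<n. integral (cbox a b) (f i))"
    by (intro ext has_integral_unique[OF I])
  then show ?thesis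
    using lim integral_unique[OF J] by (simp add: sums_def)
qed

lemma integral_cis_period:
  "integral (cbox 0 1) (\<lambda>u. cis (2 * pi * (real m - real n) * u)) = (if m = n then 1 else 0)"
proof (cases "m = n")
  case False
  define k where "k = 2 * pi * (real m - real n)"
  have k: "k \<noteq> 0" using False by (simp add: k_def)
  have "((\<lambda>u. cis (k * u)) has_integral (cis (k * 1) / (\<i> * k) - cis (k * 0) / (\<i> * k))) {0..1}"
  proof (rule fundamental_theorem_of_calculus)
    fix u :: real assume "u \<in> {0..1}"
    show "((\<lambda>u. cis (k * u) / (\<i> * k)) has_vector_derivative cis (k * u)) (at u within {0..1})"
      unfolding cis_conv_exp using k
      by (auto intro!: derivative_eq_intros has_vector_derivative_real_field simp: field_simps)
  qed simp
  moreover have "cis (k * 1) = 1"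
  proof -
    have "k = 2 * pi * of_int (int m - int n)" by (simp add: k_def)
    then show ?thesis using cis_multiple_2pi[of "of_int (int m - int n)"] by simp
  qed
  ultimately show ?thesis using False by (simp add: k_def integral_unique)
qed simp

text \<open>Absolute summability makes all series converge uniformly, so that orthogonality of the
  characters can be used twice: to read off the coefficients of the sum \<open>F\<close>, and to
  integrate \<open>F * cnj F\<close> term by term.\<close>

lemma parseval_absolutely_summable:
  fixes c :: "nat \<Rightarrow> complex"
  assumes c: "summable (\<lambda>n. cmod (c n))"
  shows "(\<lambda>n. (cmod (c n))\<^sup>2) sums
    integral (cbox 0 1) (\<lambda>u. (cmod (\<Sum>n. c n * cis (2 * pi * real n * u)))\<^sup>2)"
proof -
  define F where "F u = (\<Sum>n. c n * cis (2 * pi * real n * u))" for u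
  have cont_term: "continuous_on S (\<lambda>u. c n * cis (2 * pi * real n * u))" for n S
    by (intro continuous_intros)
  have norm_term: "norm (c n * cis (2 * pi * real n * u)) \<le> cmod (c n)" for n u
    by (simp add: norm_mult)
  have contF: "continuous_on (cbox 0 1) F"
    unfolding F_def
    by (rule uniform_limit_theorem[OF _ Weierstrass_m_test[OF norm_term c]])
      (auto intro!: always_eventually continuous_on_sum cont_term)
  have F_le: "cmod (F u) \<le> (\<Sum>n. cmod (c n))" for u
    unfolding F_def
    by (rule order_trans[OF summable_norm suminf_le]) 
      (auto simp: norm_mult c intro: summable_norm_cancel)
  have F_sums: "(\<lambda>n. c n * cis (2 * pi * real n * u)) sums F u" for u
    unfolding F_def by (rule summable_sums[OF summable_norm_cancel]) (simp add: norm_mult c)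
  have coeff: "integral (cbox 0 1) (\<lambda>u. F u * cnj (cis (2 * pi * real m * u))) = c m" for m
  proof -
    have "(\<lambda>n. integral (cbox 0 1) (\<lambda>u. c n * cis (2 * pi * real n * u) * cnj (cis (2 * pi * real m * u))))
       sums integral (cbox 0 1) (\<lambda>u. \<Sum>n. c n * cis (2 * pi * real n * u) * cnj (cis (2 * pi * real m * u)))"
      by (rule integral_sums[OF _ _ c]) (auto simp: norm_mult intro!: continuous_intros)
    also have "(\<lambda>n. integral (cbox 0 1) (\<lambda>u. c n * cis (2 * pi * real n * u) * cnj (cis (2 * pi * real m * u))))
        = (\<lambda>n. if n = m then c m else 0)"
    proof
      fix n
      have "c n * cis (2 * pi * real n * u) * cnj (cis (2 * pi * real m * u))
          = c n * cis (2 * pi * (real n - real m) * u)" for u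
        by (simp add: cis_cnj cis_mult mult.assoc algebra_simps)
      then show "integral (cbox 0 1) (\<lambda>u. c n * cis (2 * pi * real n * u) * cnj (cis (2 * pi * real m * u)))
        = (if n = m then c m else 0)"
        using integral_cis_period[of n m] by (simp only: integral_mult_right) simp
    qed
    also have "(\<lambda>u. \<Sum>n. c n * cis (2 * pi * real n * u) * cnj (cis (2 * pi * real m * u)))
       = (\<lambda>u. F u * cnj (cis (2 * pi * real m * u)))"
      using sums_unique[OF sums_mult2[OF F_sums]] by (simp add: fun_eq_iff)
    finally show ?thesis
      using sums_single[of m "\<lambda>_. c m"] sums_unique2 by blast
  qed
  have "(\<lambda>n. integral (cbox 0 1) (\<lambda>u. F u * cnj (c n * cis (2 * pi * real n * u))))
     sums integral (cbox 0 1) (\<lambda>u. \<Sum>n. F u * cnj (c n * cis (2 * pi * real n * u)))"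
  proof (rule integral_sums)
    show "summable (\<lambda>n. (\<Sum>n. cmod (c n)) * cmod (c n))"
      by (intro summable_mult c)
    show "norm (F u * cnj (c n * cis (2 * pi * real n * u))) \<le> (\<Sum>n. cmod (c n)) * cmod (c n)" for n u
      by (simp add: norm_mult mult_right_mono F_le)
  qed (intro continuous_intros contF)
  also have "(\<lambda>n. integral (cbox 0 1) (\<lambda>u. F u * cnj (c n * cis (2 * pi * real n * u))))
     = (\<lambda>n. complex_of_real ((cmod (c n))\<^sup>2))"
  proof
    fix n
    have "integral (cbox 0 1) (\<lambda>u. F u * cnj (c n * cis (2 * pi * real n * u)))
       = integral (cbox 0 1) (\<lambda>u. cnj (c n) * (F u * cnj (cis (2 * pi * real n * u))))"
      by (simp add: mult_ac)
    also have "\<dots> = cnj (c n) * c n"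
      using coeff[of n] by (simp del: cbox_interval)
    finally show "integral (cbox 0 1) (\<lambda>u. F u * cnj (c n * cis (2 * pi * real n * u)))
        = complex_of_real ((cmod (c n))\<^sup>2)"
      by (simp add: complex_norm_square mult.commute del: of_real_power)
  qed
  also have "(\<lambda>u. \<Sum>n. F u * cnj (c n * cis (2 * pi * real n * u))) = (\<lambda>u. complex_of_real ((cmod (F u))\<^sup>2))"
  proof
    fix u
    have "(\<lambda>n. F u * cnj (c n * cis (2 * pi * real n * u))) sums (F u * cnj (F u))"
      using F_sums[of u] by (intro sums_mult) (simp only: sums_cnj)
    then show "(\<Sum>n. F u * cnj (c n * cis (2 * pi * real n * u))) = complex_of_real ((cmod (F u))\<^sup>2)"
      by (simp add: sums_iff complex_norm_square del: of_real_power complex_cnj_mult)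
  qed
  also have "integral (cbox 0 1) (\<lambda>u. complex_of_real ((cmod (F u))\<^sup>2))
     = complex_of_real (integral (cbox 0 1) (\<lambda>u. (cmod (F u))\<^sup>2))"
  proof -
    have "(\<lambda>u. (cmod (F u))\<^sup>2) integrable_on cbox 0 1"
      by (intro integrable_continuous continuous_intros contF)
    from has_integral_of_real[OF integrable_integral[OF this]] show ?thesis
      by (rule integral_unique)
  qed
  finally show ?thesis
    unfolding sums_of_real_iff F_def .
qed

definition squared_poisson :: "real \<Rightarrow> nat \<Rightarrow> real" where
  "squared_poisson s n = (exp (- s) * s ^ n / fact n)\<^sup>2"

text \<open>Parseval's identity for the exponential series \<open>exp (s * (z * cis (2 * pi * u) -
  1))\<close> in the variable \<open>u\<close>.\<close>

lemma squared_poisson_power_series: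
  assumes "0 \<le> s"
  shows "(\<lambda>n. squared_poisson s n * cmod z ^ (2 * n)) sums
    integral (cbox 0 1) (\<lambda>u. exp (2 * s * (Re (z * cis (2 * pi * u)) - 1)))"
proof -
  define c where "c n = complex_of_real (exp (- s)) * (of_real s * z) ^ n /\<^sub>R fact n" for n
  have "summable (\<lambda>n. exp (- s) * norm ((of_real s * z) ^ n /\<^sub>R fact n))"
    by (intro summable_mult summable_norm_exp)
  then have c: "summable (\<lambda>n. cmod (c n))"
    by (simp add: c_def norm_mult mult_ac)
  have "(cmod (c n))\<^sup>2 = squared_poisson s n * cmod z ^ (2 * n)" for n
    using assms by (simp add: c_def squared_poisson_def norm_mult norm_power norm_divide
        power_mult_distrib power_divide power_mult[symmetric] mult.commute field_simps)
  moreover have "(\<Sum>n. c n * cis (2 * pi * real n * u)) = exp (of_real s * (z * cis (2 * pi * u) - 1))" for u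
  proof -
    have "(\<lambda>n. complex_of_real (exp (- s)) * ((of_real s * z * cis (2 * pi * u)) ^ n /\<^sub>R fact n))
       sums (complex_of_real (exp (- s)) * exp (of_real s * z * cis (2 * pi * u)))"
      by (intro sums_mult exp_converges)
    also have "(\<lambda>n. complex_of_real (exp (- s)) * ((of_real s * z * cis (2 * pi * u)) ^ n /\<^sub>R fact n))
       = (\<lambda>n. c n * cis (2 * pi * real n * u))"
      by (simp add: c_def fun_eq_iff power_mult_distrib Complex.DeMoivre mult_ac)
    also have "complex_of_real (exp (- s)) * exp (of_real s * z * cis (2 * pi * u))
       = exp (of_real s * (z * cis (2 * pi * u) - 1))"
      by (simp add: exp_of_real[symmetric] exp_add[symmetric] algebra_simps)
    finally show ?thesis by (rule sums_unique[symmetric])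
  qed
  moreover have "(cmod (exp (of_real s * (z * cis (2 * pi * u) - 1))))\<^sup>2
      = exp (2 * s * (Re (z * cis (2 * pi * u)) - 1))" for u
    by (simp add: exp_double[symmetric] power2_eq_square exp_add[symmetric] del: Re_complex_of_real)
       (simp add: algebra_simps)
  ultimately show ?thesis
    using parseval_absolutely_summable[OF c] by (simp del: cbox_interval)
qed

lemma summable_squared_poisson:
  assumes "0 \<le> s" shows "summable (squared_poisson s)"
  using squared_poisson_power_series[OF assms, of 1] by (simp add: sums_iff del: cbox_interval)

lemma squared_poisson_nonneg: "0 \<le> squared_poisson s n"
  by (simp add: squared_poisson_def)

section \<open>Translation invariance of torus integrals\<close>

lemma torus_fun_add_int:
  assumes "torus_fun g" shows "g (t + of_int k *\<^sub>R axis j 1) = g t"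
proof (induction k arbitrary: t rule: int_induct[where k = 0])
  case (step1 i)
  have "g (t + of_int (i + 1) *\<^sub>R axis j 1) = g (t + of_int i *\<^sub>R axis j 1 + axis j 1)"
    by (simp add: algebra_simps)
  also have "\<dots> = g t" using assms step1 unfolding torus_fun_def by simp
  finally show ?case .
next
  case (step2 i)
  have "g (t + of_int (i - 1) *\<^sub>R axis j 1) = g (t + of_int (i - 1) *\<^sub>R axis j 1 + axis j 1)"
    using assms unfolding torus_fun_def by metis
  also have "t + of_int (i - 1) *\<^sub>R axis j 1 + axis j 1 = t + of_int i *\<^sub>R axis j 1"
    by (simp add: algebra_simps)
  finally show ?case using step2 by simp
qed simp

lemma torus_fun_translate: "torus_fun g \<Longrightarrow> torus_fun (\<lambda>t. g (t + a))"
  unfolding torus_fun_def by (metis add.assoc add.commute)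

lemma continuous_on_translate:
  fixes g :: "'a::real_normed_vector \<Rightarrow> 'b::topological_space"
  assumes "continuous_on UNIV g" shows "continuous_on S (\<lambda>t. g (t + a))"
  by (rule continuous_on_compose2[OF assms]) (auto intro: continuous_intros)

text \<open>The part of the unit cube that a shift along one axis pushes out is, modulo the
  period, the part that it uncovers.\<close>

lemma torus_integral_shift_axis_unit:
  fixes h :: "real ^ 'd::finite \<Rightarrow> 'b::euclidean_space"
  assumes h: "torus_fun h" "continuous_on UNIV h" and s: "0 \<le> s" "s \<le> 1"
  shows "integral (cbox 0 1) (\<lambda>t. h (t + s *\<^sub>R axis j 1)) = integral (cbox 0 1) h"
proof -
  define e :: "real ^ 'd" where "e = axis j 1"
  have e: "e $ i = (if i = j then 1 else 0)" for i by (simp add: e_def axis_def)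
  have eB: "e \<in> Basis" by (simp add: e_def axis_in_Basis_iff)
  have inner: "x \<bullet> e = x $ j" for x by (simp add: e_def inner_axis)
  have box: "cbox 0 1 \<inter> {x. x \<bullet> e \<le> r} = cbox 0 (1 - (1 - r) *\<^sub>R e)"
       "cbox 0 1 \<inter> {x. x \<bullet> e \<ge> r} = cbox (r *\<^sub>R e) 1" if "0 \<le> r" "r \<le> 1" for r
    using that by (auto simp: mem_box_cart inner e split: if_splits) (metis order_trans)+
  have split: "integral (cbox 0 1) f
      = integral (cbox 0 (1 - (1 - r) *\<^sub>R e)) f + integral (cbox (r *\<^sub>R e) 1) f"
    if "continuous_on UNIV f" "0 \<le> r" "r \<le> 1" for f :: "real ^ 'd \<Rightarrow> 'b" and r
    using integral_split[OF integrable_continuous[OF continuous_on_subset[OF that(1) subset_UNIV]] eB,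
      of 0 1 r]
    by (simp add: box that)
  \<comment> \<open>By periodicity a shift by \<open>s\<close> acts on the outer slab as a shift back by \<open>1 - s\<close>.\<close>
  have per: "h (t + s *\<^sub>R e) = h (t + - ((1 - s) *\<^sub>R e))" for t
  proof -
    have "h (t + - ((1 - s) *\<^sub>R e)) = h (t + - ((1 - s) *\<^sub>R e) + e)"
      using h(1) unfolding torus_fun_def e_def by metis
    then show ?thesis by (simp add: algebra_simps)
  qed
  have "integral (cbox 0 1) (\<lambda>t. h (t + s *\<^sub>R e))
     = integral (cbox 0 (1 - s *\<^sub>R e)) (\<lambda>t. h (t + s *\<^sub>R e))
      + integral (cbox ((1 - s) *\<^sub>R e) 1) (\<lambda>t. h (t + s *\<^sub>R e))"
    using split[OF continuous_on_translate[OF h(2)], of "1 - s"] s by simp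
  also have "integral (cbox 0 (1 - s *\<^sub>R e)) (\<lambda>t. h (t + s *\<^sub>R e)) = integral (cbox (s *\<^sub>R e) 1) h"
    using integral_shift_cbox[of "s *\<^sub>R e" "s *\<^sub>R e" 1 h] by simp
  also have "integral (cbox ((1 - s) *\<^sub>R e) 1) (\<lambda>t. h (t + s *\<^sub>R e))
      = integral (cbox 0 (1 - (1 - s) *\<^sub>R e)) h"
    using integral_shift_cbox[of 0 "- ((1 - s) *\<^sub>R e)" "1 - (1 - s) *\<^sub>R e" h]
    unfolding per by simp
  also have "integral (cbox (s *\<^sub>R e) 1) h + integral (cbox 0 (1 - (1 - s) *\<^sub>R e)) h = integral (cbox 0 1) h"
    using split[OF h(2) s] by simp
  finally show ?thesis by (simp add: e_def)
qed

lemma torus_integral_shift_axis: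
  fixes h :: "real ^ 'd::finite \<Rightarrow> 'b::euclidean_space"
  assumes h: "torus_fun h" "continuous_on UNIV h"
  shows "integral (cbox 0 1) (\<lambda>t. h (t + s *\<^sub>R axis j 1)) = integral (cbox 0 1) h"
proof -
  have "h (t + s *\<^sub>R axis j 1) = h (t + frac s *\<^sub>R axis j 1)" for t
    using torus_fun_add_int[OF h(1), of "t + frac s *\<^sub>R axis j 1" "\<lfloor>s\<rfloor>" j]
    by (simp add: frac_def algebra_simps)
  then show ?thesis
    using torus_integral_shift_axis_unit[OF h, of "frac s" j] frac_lt_1[of s]
    by (simp add: less_imp_le)
qed

text \<open>A translation is a composition of translations along the axes.\<close>

lemma torus_integral_translate:
  fixes g :: "real ^ 'd::finite \<Rightarrow> 'b::euclidean_space"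
  assumes g: "torus_fun g" "continuous_on UNIV g"
  shows "integral (cbox 0 1) (\<lambda>t. g (t + a)) = integral (cbox 0 1) g"
proof -
  have "integral (cbox 0 1) (\<lambda>t. g (t + (\<Sum>j\<in>A. a $ j *\<^sub>R axis j 1))) = integral (cbox 0 1) g"
    if "finite A" for A
    using that
  proof (induction A rule: finite_induct)
    case (insert j A)
    have "integral (cbox 0 1) (\<lambda>t. g (t + a $ j *\<^sub>R axis j 1 + (\<Sum>j\<in>A. a $ j *\<^sub>R axis j 1)))
       = integral (cbox 0 1) (\<lambda>t. g (t + (\<Sum>j\<in>A. a $ j *\<^sub>R axis j 1)))"
      by (rule torus_integral_shift_axis[OF torus_fun_translate[OF g(1)] continuous_on_translate[OF g(2)]])
    then show ?case using insert by (simp add: add.assoc)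
  qed simp
  from this[of UNIV] show ?thesis
    using basis_expansion[of a] by (simp add: scalar_mult_eq_scaleR)
qed

lemma torus_integral_cbox_translate:
  fixes g :: "real ^ 'd::finite \<Rightarrow> 'b::euclidean_space"
  assumes g: "torus_fun g" "continuous_on UNIV g"
  shows "integral (cbox a (a + 1)) g = integral (cbox 0 1) g"
  using integral_shift_cbox[of a a "a + 1" g] torus_integral_translate[OF g, of a] by simp

section \<open>Laplace's method on the torus\<close>

text \<open>Only some positive multiple of \<open>\<bar>x\<bar>\<close> is wanted, to dominate the
  kernel by a Gaussian; the crude constant follows from the cubic Taylor bound and \<open>3 < pi <
  4\<close>.\<close>

lemma abs_sin_pi_lower_bound:
  assumes "\<bar>x\<bar> \<le> 1 / 2" shows "\<bar>x\<bar> \<le> \<bar>sin (pi * x)\<bar>"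
proof -
  let ?y = "pi * x"
  have "\<bar>?y\<bar> \<le> 4 * (1 / 2)"
    unfolding abs_mult using assms pi_less_4 by (intro mult_mono) auto
  then have "\<bar>?y\<bar>\<^sup>2 \<le> 2\<^sup>2" by (intro power_mono) auto
  then have "\<bar>?y\<bar> * \<bar>?y\<bar>\<^sup>2 \<le> \<bar>?y\<bar> * 4" by (intro mult_left_mono) auto
  then have "\<bar>?y\<bar> ^ 3 \<le> 4 * \<bar>?y\<bar>" by (simp add: power2_eq_square power3_eq_cube mult_ac)
  moreover have "\<bar>sin ?y - ?y\<bar> \<le> \<bar>?y\<bar> ^ 3 / 6"
    using Maclaurin_sin_bound[of ?y 3] by (simp add: sin_coeff_def eval_nat_numeral divide_simps)
  ultimately have "\<bar>?y\<bar> / 3 \<le> \<bar>sin ?y\<bar>" by linarith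
  moreover have "\<bar>x\<bar> \<le> \<bar>?y\<bar> / 3"
    using pi_gt3 mult_right_mono[of 3 pi "\<bar>x\<bar>"] by (simp add: abs_mult)
  ultimately show ?thesis by linarith
qed

lemma nn_integral_gaussian:
  assumes "0 < c"
  shows "(\<integral>\<^sup>+x. ennreal (exp (- c * x\<^sup>2)) \<partial>lborel) = ennreal (sqrt (pi / c))"
proof -
  \<comment> \<open>The standard deviation for which the normal density is proportional to the integrand.\<close>
  define \<sigma> where "\<sigma> = sqrt (1 / (2 * c))"
  have s: "\<sigma>\<^sup>2 = 1 / (2 * c)" "\<sigma> > 0" using assms by (auto simp: \<sigma>_def)
  have "exp (- c * x\<^sup>2) = sqrt (pi / c) * normal_density 0 \<sigma> x" for x
    using assms by (simp add: normal_density_def s)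
  moreover have "(\<integral>\<^sup>+x. ennreal (normal_density 0 \<sigma> x) \<partial>lborel) = 1"
    using s(2) by (subst nn_integral_eq_integral) auto
  ultimately show ?thesis
    using assms by (simp add: ennreal_mult nn_integral_cmult)
qed

lemma has_bochner_integral_gaussian_vec:
  fixes c :: "real ^ 'd::finite"
  assumes c: "\<And>j. 0 < c $ j"
  shows "has_bochner_integral lborel (\<lambda>x. exp (- (\<Sum>j\<in>UNIV. c $ j * (x $ j)\<^sup>2))) (\<Prod>j\<in>UNIV. sqrt (pi / c $ j))"
proof (rule has_bochner_integral_nn_integral)
  have basis: "(Basis :: (real ^ 'd) set) = (\<lambda>j. axis j 1) ` UNIV"
    by (auto simp: Basis_vec_def)
  have inj: "inj (\<lambda>j::'d. axis j (1::real))"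
    by (simp add: inj_on_def axis_eq_axis)
  have "exp (- (\<Sum>j\<in>UNIV. c $ j * (x $ j)\<^sup>2)) = (\<Prod>b\<in>Basis. exp (- (c \<bullet> b) * (x \<bullet> b)\<^sup>2))" for x
    unfolding basis prod.reindex[OF inj]
    by (simp add: inner_axis exp_sum[symmetric] sum_negf)
  then have "(\<integral>\<^sup>+x. ennreal (exp (- (\<Sum>j\<in>UNIV. c $ j * (x $ j)\<^sup>2))) \<partial>lborel)
     = (\<integral>\<^sup>+x. (\<Prod>b\<in>Basis. ennreal (exp (- (c \<bullet> b) * (x \<bullet> b)\<^sup>2))) \<partial>lborel)"
    by (simp add: prod_ennreal)
  also have "\<dots> = (\<Prod>b\<in>Basis. \<integral>\<^sup>+y. ennreal (exp (- (c \<bullet> b) * y\<^sup>2)) \<partial>lborel)"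
    by (rule nn_integral_lborel_prod) auto
  also have "\<dots> = (\<Prod>j\<in>UNIV. ennreal (sqrt (pi / c $ j)))"
    unfolding basis prod.reindex[OF inj] o_def inner_axis using c
    by (intro prod.cong refl) (simp add: nn_integral_gaussian[simplified])
  also have "\<dots> = ennreal (\<Prod>j\<in>UNIV. sqrt (pi / c $ j))"
    using c by (intro prod_ennreal) (simp add: less_imp_le)
  finally show "(\<integral>\<^sup>+x. ennreal (exp (- (\<Sum>j\<in>UNIV. c $ j * (x $ j)\<^sup>2))) \<partial>lborel)
      = ennreal (\<Prod>j\<in>UNIV. sqrt (pi / c $ j))" .
qed (simp_all add: prod_nonneg c less_imp_le)

lemma lborel_integral_scale:
  fixes h :: "'a::euclidean_space \<Rightarrow> real"
  assumes [measurable]: "h \<in> borel_measurable borel" and c: "0 < c"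
  shows "(\<integral>x. h x \<partial>lborel) = c ^ DIM('a) * (\<integral>x. h (c *\<^sub>R x) \<partial>lborel)"
proof -
  have "(\<integral>x. h x \<partial>lborel) = (\<integral>x. h x \<partial>density (distr lborel borel (\<lambda>x. 0 + c *\<^sub>R x)) (\<lambda>_. ennreal (\<bar>c\<bar> ^ DIM('a))))"
    using lborel_affine[of c "0::'a"] c by simp
  also have "\<dots> = c ^ DIM('a) * (\<integral>x. h (c *\<^sub>R x) \<partial>lborel)"
    using c by (subst integral_density) (auto simp: integral_distr)
  finally show ?thesis .
qed

text \<open>The periodic analogue of a Gaussian with diagonal covariance; at small \<open>x\<close> the exponent is
  approximately \<open>- 4 * pi\<^sup>2 * s * (\<Sum>j. p $ j * (x $ j)\<^sup>2)\<close>.\<close>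

definition torus_gaussian :: "real ^ 'd::finite \<Rightarrow> real \<Rightarrow> real ^ 'd \<Rightarrow> real" where
  "torus_gaussian p s x = exp (- 4 * s * (\<Sum>j\<in>UNIV. p $ j * (sin (pi * x $ j))\<^sup>2))"

lemma torus_gaussian_scaled_tendsto:
  fixes p :: "real ^ 'd::finite"
  shows "((\<lambda>s. torus_gaussian p s ((1 / sqrt s) *\<^sub>R x))
     \<longlongrightarrow> exp (- (\<Sum>j\<in>UNIV. 4 * pi\<^sup>2 * p $ j * (x $ j)\<^sup>2))) at_top"
proof -
  have lim: "((\<lambda>s. s * (sin (pi * (y / sqrt s)))\<^sup>2) \<longlongrightarrow> pi\<^sup>2 * y\<^sup>2) at_top" for y :: real
  proof -
    have r: "((\<lambda>s. inverse (sqrt s)) \<longlongrightarrow> 0) at_top"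
      by (rule tendsto_inverse_0_at_top[OF sqrt_at_top])
    have "((\<lambda>t. sin (pi * y * t)) has_real_derivative pi * y) (at 0)"
      by (auto intro!: derivative_eq_intros)
    then have d: "((\<lambda>t. sin (pi * y * t) / t) \<longlongrightarrow> pi * y) (at 0)"
      using DERIV_D by fastforce
    have ev: "eventually (\<lambda>s. inverse (sqrt s) \<noteq> 0) at_top"
      using eventually_gt_at_top[of 0] by eventually_elim simp
    have "((\<lambda>s. sin (pi * y * inverse (sqrt s)) / inverse (sqrt s)) \<longlongrightarrow> pi * y) at_top"
      by (rule filterlim_compose[OF d]) (simp add: filterlim_at r ev)
    then have "((\<lambda>s. (sin (pi * y * inverse (sqrt s)) / inverse (sqrt s))\<^sup>2) \<longlongrightarrow> (pi * y)\<^sup>2) at_top"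
      by (rule tendsto_power)
    moreover have "\<forall>\<^sub>F s in at_top. (sin (pi * y * inverse (sqrt s)) / inverse (sqrt s))\<^sup>2
        = s * (sin (pi * (y / sqrt s)))\<^sup>2"
      using eventually_gt_at_top[of 0]
      by eventually_elim (simp add: power_divide power_mult_distrib field_simps)
    ultimately show ?thesis
      by (simp add: power_mult_distrib filterlim_cong[OF refl refl])
  qed
  have "((\<lambda>s. exp (\<Sum>j\<in>UNIV. - 4 * p $ j * (s * (sin (pi * (x $ j / sqrt s)))\<^sup>2)))
     \<longlongrightarrow> exp (\<Sum>j\<in>UNIV. - 4 * p $ j * (pi\<^sup>2 * (x $ j)\<^sup>2))) at_top"
    by (intro tendsto_intros lim)
  then show ?thesis
    by (simp add: torus_gaussian_def sum_distrib_left sum_negf mult_ac)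
qed

lemma torus_gaussian_le:
  assumes "\<And>j. 0 \<le> p $ j" "0 < s" "\<And>j. \<bar>x $ j\<bar> \<le> sqrt s / 2"
  shows "torus_gaussian p s ((1 / sqrt s) *\<^sub>R x) \<le> exp (- (\<Sum>j\<in>UNIV. p $ j * (x $ j)\<^sup>2))"
proof -
  have "p $ j * (x $ j)\<^sup>2 \<le> 4 * s * (p $ j * (sin (pi * ((1 / sqrt s) *\<^sub>R x) $ j))\<^sup>2)" for j
  proof -
    let ?y = "x $ j / sqrt s"
    have "\<bar>?y\<bar> \<le> 1 / 2" using assms(2) assms(3)[of j] by (simp add: field_simps)
    then have "?y\<^sup>2 \<le> (sin (pi * ?y))\<^sup>2"
      using abs_sin_pi_lower_bound abs_le_square_iff by blast
    then have "(x $ j)\<^sup>2 \<le> s * (sin (pi * ?y))\<^sup>2"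
      using assms(2) by (simp add: power_divide field_simps)
    moreover have "0 \<le> s * (sin (pi * ?y))\<^sup>2" using assms(2) by simp
    ultimately have "(x $ j)\<^sup>2 \<le> 4 * (s * (sin (pi * ?y))\<^sup>2)" by linarith
    from mult_left_mono[OF this assms(1)[of j]] show ?thesis by (simp add: mult_ac)
  qed
  then have "(\<Sum>j\<in>UNIV. p $ j * (x $ j)\<^sup>2)
      \<le> 4 * s * (\<Sum>j\<in>UNIV. p $ j * (sin (pi * ((1 / sqrt s) *\<^sub>R x) $ j))\<^sup>2)"
    unfolding sum_distrib_left by (intro sum_mono)
  then show ?thesis by (simp add: torus_gaussian_def)
qed

lemma continuous_on_torus_gaussian [continuous_intros]:
  fixes f :: "'a::euclidean_space \<Rightarrow> real ^ 'd::finite"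
  assumes "continuous_on S f" shows "continuous_on S (\<lambda>x. torus_gaussian p s (f x))"
  unfolding torus_gaussian_def by (intro continuous_intros continuous_on_component assms)

text \<open>Rescaling \<open>x\<close> by \<open>1 / sqrt s\<close> turns the integral over the
  cube into one over growing cubes, with integrand converging to \<open>\<psi> 0\<close> times a
  Gaussian with diagonal covariance and dominated by another Gaussian.\<close>

lemma laplace_torus_gaussian:
  fixes p :: "real ^ 'd::finite" and \<psi> :: "real ^ 'd \<Rightarrow> real"
  assumes p: "\<And>j. 0 < p $ j" and cont: "continuous_on UNIV \<psi>"
  shows "((\<lambda>s. sqrt s ^ CARD('d) * integral (cbox (- (1 / 2) *\<^sub>R 1) ((1 / 2) *\<^sub>R 1)) (\<lambda>x. \<psi> x * torus_gaussian p s x))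
     \<longlongrightarrow> \<psi> 0 / (\<Prod>j\<in>UNIV. sqrt (4 * pi * p $ j))) at_top"
proof -
  let ?Q = "cbox (- (1 / 2) *\<^sub>R 1) ((1 / 2) *\<^sub>R 1) :: (real ^ 'd) set"
  have memQ: "x \<in> ?Q \<longleftrightarrow> (\<forall>j. \<bar>x $ j\<bar> \<le> 1 / 2)" for x
    unfolding mem_box_cart by (intro iff_allI) (simp, linarith)
  define h where "h s x = indicator ?Q x * (\<psi> x * torus_gaussian p s x)" for s x
  have contg: "continuous_on A (\<lambda>x. \<psi> x * torus_gaussian p s x)" for A s
    by (intro continuous_intros continuous_on_subset[OF cont subset_UNIV])
  have meas [measurable]: "h s \<in> borel_measurable borel" for s
    unfolding h_def
    by (intro borel_measurable_times borel_measurable_indicator borel_measurable_continuous_onI contg) auto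
  have eq: "integral ?Q (\<lambda>x. \<psi> x * torus_gaussian p s x) = (\<integral>x. h s x \<partial>lborel)" for s
  proof -
    have "set_integrable lborel ?Q (\<lambda>x. \<psi> x * torus_gaussian p s x)"
      using borel_integrable_compact[OF compact_cbox contg] by (simp add: set_integrable_def)
    from set_borel_integral_eq_integral(2)[OF this] show ?thesis
      by (simp add: set_lebesgue_integral_def h_def)
  qed
  have scaled: "\<forall>\<^sub>F s in at_top. (\<integral>x. h s ((1 / sqrt s) *\<^sub>R x) \<partial>lborel)
      = sqrt s ^ CARD('d) * integral ?Q (\<lambda>x. \<psi> x * torus_gaussian p s x)"
    using eventually_gt_at_top[of 0]
  proof eventually_elim
    case (elim s)
    then show ?case
      unfolding eq using lborel_integral_scale[OF meas, of "1 / sqrt s" s]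
      by (simp add: power_divide)
  qed
  obtain B where B: "\<And>x. x \<in> ?Q \<Longrightarrow> \<bar>\<psi> x\<bar> \<le> B"
    using compact_imp_bounded[OF compact_continuous_image[OF continuous_on_subset[OF cont subset_UNIV] compact_cbox]]
    unfolding bounded_iff by (metis imageI real_norm_def)
  have "0 \<in> ?Q" unfolding memQ by simp
  from B[OF this] have B0: "0 \<le> B" by linarith
  let ?w = "\<lambda>x. B * exp (- (\<Sum>j\<in>UNIV. p $ j * (x $ j)\<^sup>2))"
  let ?c = "\<chi> j. 4 * pi\<^sup>2 * p $ j"
  let ?g = "\<lambda>x. \<psi> 0 * exp (- (\<Sum>j\<in>UNIV. 4 * pi\<^sup>2 * p $ j * (x $ j)\<^sup>2))"
  have gauss: "has_bochner_integral lborel (\<lambda>x. exp (- (\<Sum>j\<in>UNIV. 4 * pi\<^sup>2 * p $ j * (x $ j)\<^sup>2)))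
     (\<Prod>j\<in>UNIV. sqrt (pi / (4 * pi\<^sup>2 * p $ j)))"
    using has_bochner_integral_gaussian_vec[of ?c] p by simp
  have "((\<lambda>s. \<integral>x. h s ((1 / sqrt s) *\<^sub>R x) \<partial>lborel) \<longlongrightarrow> (\<integral>x. ?g x \<partial>lborel)) at_top"
  proof (rule integral_dominated_convergence_at_top)
    show "integrable lborel ?w"
      using has_bochner_integral_gaussian_vec[OF p] by (auto simp: has_bochner_integral_iff)
    show "\<forall>\<^sub>F s in at_top. AE x in lborel. norm (h s ((1 / sqrt s) *\<^sub>R x)) \<le> ?w x"
      using eventually_gt_at_top[of 0]
    proof eventually_elim
      case (elim s)
      have "norm (h s ((1 / sqrt s) *\<^sub>R x)) \<le> ?w x" for x
      proof (cases "(1 / sqrt s) *\<^sub>R x \<in> ?Q")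
        case True
        then have "\<bar>x $ j\<bar> \<le> sqrt s / 2" for j
          using elim unfolding memQ by (auto simp: field_simps dest: spec[of _ j])
        from torus_gaussian_le[OF less_imp_le[OF p] elim this] show ?thesis
          using True B[OF True] B0
          by (auto simp: h_def abs_mult torus_gaussian_def intro!: mult_mono)
      qed (simp add: h_def B0)
      then show ?case by simp
    qed
    show "AE x in lborel. ((\<lambda>s. h s ((1 / sqrt s) *\<^sub>R x)) \<longlongrightarrow> ?g x) at_top"
    proof (rule AE_I2)
      fix x :: "real ^ 'd"
      have r: "((\<lambda>s. 1 / sqrt s) \<longlongrightarrow> 0) at_top"
        using tendsto_inverse_0_at_top[OF sqrt_at_top] by (simp add: inverse_eq_divide)
      have z: "((\<lambda>s. (1 / sqrt s) *\<^sub>R x) \<longlongrightarrow> 0) at_top"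
        using tendsto_scaleR[OF r tendsto_const[of x]] by simp
      have "0 \<in> interior ?Q"
        by (simp add: interior_cbox mem_box_cart)
      then have "\<forall>\<^sub>F s in at_top. (1 / sqrt s) *\<^sub>R x \<in> interior ?Q"
        using z open_interior topological_tendstoD by blast
      then have "\<forall>\<^sub>F s in at_top. \<psi> ((1 / sqrt s) *\<^sub>R x) * torus_gaussian p s ((1 / sqrt s) *\<^sub>R x) = h s ((1 / sqrt s) *\<^sub>R x)"
        by eventually_elim (auto simp: h_def dest: subsetD[OF box_subset_cbox])
      moreover have "((\<lambda>s. \<psi> ((1 / sqrt s) *\<^sub>R x) * torus_gaussian p s ((1 / sqrt s) *\<^sub>R x)) \<longlongrightarrow> ?g x) at_top"
        by (intro tendsto_mult torus_gaussian_scaled_tendsto continuous_on_tendsto_compose[OF cont z]) auto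
      ultimately show "((\<lambda>s. h s ((1 / sqrt s) *\<^sub>R x)) \<longlongrightarrow> ?g x) at_top"
        by (rule Lim_transform_eventually[rotated])
    qed
  qed (use gauss in \<open>auto simp: has_bochner_integral_iff\<close>)
  also have "(\<integral>x. ?g x \<partial>lborel) = \<psi> 0 / (\<Prod>j\<in>UNIV. sqrt (4 * pi * p $ j))"
  proof -
    have "sqrt (pi / (4 * pi\<^sup>2 * p $ j)) = 1 / sqrt (4 * pi * p $ j)" for j
      by (simp add: real_sqrt_divide real_sqrt_mult power2_eq_square)
    then show ?thesis
      using gauss by (simp add: has_bochner_integral_iff prod_dividef)
  qed
  finally show ?thesis
    by (rule Lim_transform_eventually[OF _ scaled])
qed

section \<open>A Tauberian theorem for squared Poisson weights\<close>

text \<open>A Poisson probability is at most \<open>1\<close>, hence at least its square. In the tail the factor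
  \<open>a ^ k\<close> may be replaced by \<open>a ^ n\<close>, and what is left is a Poisson probability for the mean \<open>n\<close>
  times a quantity that decays geometrically in \<open>n\<close> unless \<open>a = 1\<close>.\<close>

lemma squared_poisson_chernoff:
  assumes a: "0 < a" and tail: "(a \<le> 1 \<and> n \<le> k) \<or> (1 \<le> a \<and> k \<le> n)"
  shows "squared_poisson (a * real n) k \<le> (a * exp (1 - a)) ^ n * (exp (- real n) * real n ^ k / fact k)"
proof -
  define s where "s = a * real n"
  have s: "0 \<le> s" using a by (simp add: s_def)
  define q where "q = exp (- s) * s ^ k / fact k"
  have "s ^ k / fact k \<le> exp s"
  proof -
    have "(\<Sum>i\<in>{k}. s ^ i /\<^sub>R fact i) \<le> (\<Sum>i. s ^ i /\<^sub>R fact i)"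
      using s by (intro sum_le_suminf summable_exp_generic) auto
    then show ?thesis by (simp add: exp_def field_simps)
  qed
  then have q1: "q \<le> 1"
    by (simp add: q_def exp_minus field_simps)
  have q0: "0 \<le> q" using s by (simp add: q_def)
  have "a ^ k \<le> a ^ n"
    using tail a by (auto intro: power_decreasing power_increasing)
  have "squared_poisson s k \<le> q"
    using mult_left_mono[OF q1 q0] by (simp add: squared_poisson_def q_def power2_eq_square)
  also have "q = exp (- s) * (a ^ k * real n ^ k) / fact k"
    by (simp add: q_def s_def power_mult_distrib)
  also have "\<dots> \<le> exp (- s) * (a ^ n * real n ^ k) / fact k"
    using \<open>a ^ k \<le> a ^ n\<close> by (intro divide_right_mono mult_left_mono mult_right_mono) auto
  also have "exp (- s) = exp (1 - a) ^ n * exp (- real n)"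
    by (simp add: s_def exp_of_nat_mult[symmetric] exp_add[symmetric] algebra_simps)
  finally show ?thesis by (simp add: s_def power_mult_distrib mult_ac)
qed

lemma mult_exp_one_minus_less_one:
  assumes "0 < a" "a \<noteq> 1" shows "a * exp (1 - a) < (1::real)"
proof -
  have "ln a < a - 1"
    using assms ln_le_minus_one[of a] ln_eq_minus_one[of a] by fastforce
  then have "exp (ln a + (1 - a)) < exp 0" by (intro exp_less_mono) simp
  then show ?thesis using assms by (simp add: exp_add)
qed

lemma poisson_sums: "(\<lambda>k. exp (- x) * x ^ k / fact k) sums (1::real)"
  using sums_mult[OF exp_converges[of x], of "exp (- x)"]
  by (simp add: exp_minus field_simps)

text \<open>For \<open>k\<close> on one side of \<open>n\<close> monotonicity compares \<open>A k\<close> with \<open>A n\<close>; on the other side the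
  Chernoff bound makes the weight negligible.\<close>

lemma
  fixes A :: "nat \<Rightarrow> real"
  assumes A: "decseq A" "\<And>n. 0 \<le> A n" and a: "0 < a"
  shows squared_poisson_average_lower:
      "a \<le> 1 \<Longrightarrow> A n * (\<Sum>k. squared_poisson (a * real n) k)
        \<le> (\<Sum>k. squared_poisson (a * real n) k * A k) + A 0 * (a * exp (1 - a)) ^ n"
    and squared_poisson_average_upper:
      "1 \<le> a \<Longrightarrow> (\<Sum>k. squared_poisson (a * real n) k * A k)
        \<le> A n * (\<Sum>k. squared_poisson (a * real n) k) + A 0 * (a * exp (1 - a)) ^ n"
proof -
  let ?w = "squared_poisson (a * real n)"
  define b where "b k = A 0 * ((a * exp (1 - a)) ^ n * (exp (- real n) * real n ^ k / fact k))" for k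
  have le0: "A k \<le> A 0" for k using A(1) by (simp add: decseq_def)
  have b: "b sums (A 0 * (a * exp (1 - a)) ^ n)"
    unfolding b_def using sums_mult[OF sums_mult[OF poisson_sums]] by fastforce
  have b0: "0 \<le> b k" for k unfolding b_def using a A(2) by simp
  have w0: "0 \<le> ?w k" for k by (rule squared_poisson_nonneg)
  have sw: "summable ?w" using a by (simp add: summable_squared_poisson)
  have swA: "summable (\<lambda>k. ?w k * A k)"
    by (rule summable_comparison_test'[OF summable_mult2[OF sw, of "A 0"]])
      (simp add: A(2) w0 mult_left_mono le0)
  have tail: "?w k * A m \<le> b k" if "(a \<le> 1 \<and> n \<le> k) \<or> (1 \<le> a \<and> k \<le> n)" for k m
  proof -
    have "?w k * A m \<le> ?w k * A 0" by (simp add: w0 mult_left_mono le0)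
    also have "\<dots> \<le> b k"
      using mult_right_mono[OF squared_poisson_chernoff[OF a that] A(2)[of 0]]
      by (simp add: b_def mult_ac)
    finally show ?thesis .
  qed
  have bulk: "?w k * A m \<le> ?w k * A l" if "l \<le> m" for k l m
    using A(1) that by (simp add: w0 mult_left_mono decseq_def)
  {
    assume "a \<le> 1"
    have "(\<Sum>k. ?w k * A n) \<le> (\<Sum>k. ?w k * A k + b k)"
    proof (rule suminf_le)
      fix k show "?w k * A n \<le> ?w k * A k + b k"
      proof (cases "n \<le> k")
        case True
        then show ?thesis using tail[of k n] \<open>a \<le> 1\<close> A(2)[of k] w0[of k] by (simp add: add_increasing)
      next
        case False
        then show ?thesis using bulk[of k n k] b0[of k] by simp
      qed
    qed (intro summable_mult2 summable_add sw swA sums_summable[OF b])+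
    also have "\<dots> = (\<Sum>k. ?w k * A k) + A 0 * (a * exp (1 - a)) ^ n"
      using suminf_add[OF swA sums_summable[OF b]] sums_unique[OF b] by simp
    finally show "A n * suminf ?w \<le> (\<Sum>k. ?w k * A k) + A 0 * (a * exp (1 - a)) ^ n"
      using suminf_mult2[OF sw, of "A n"] by (simp add: mult.commute)
  }
  {
    assume "1 \<le> a"
    have "(\<Sum>k. ?w k * A k) \<le> (\<Sum>k. ?w k * A n + b k)"
    proof (rule suminf_le)
      fix k show "?w k * A k \<le> ?w k * A n + b k"
      proof (cases "k \<le> n")
        case True
        then show ?thesis using tail[of k k] \<open>1 \<le> a\<close> A(2)[of n] w0[of k] by (simp add: add_increasing)
      next
        case False
        then show ?thesis using bulk[of n k k] b0[of k] by simp
      qed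
    qed (intro summable_mult2 summable_add sw swA sums_summable[OF b])+
    also have "\<dots> = (\<Sum>k. ?w k * A n) + A 0 * (a * exp (1 - a)) ^ n"
      using suminf_add[OF summable_mult2[OF sw] sums_summable[OF b]] sums_unique[OF b] by simp
    finally show "(\<Sum>k. ?w k * A k) \<le> A n * suminf ?w + A 0 * (a * exp (1 - a)) ^ n"
      using suminf_mult2[OF sw, of "A n"] by (simp add: mult.commute)
  }
qed

lemma powr_times_geometric_tendsto_0:
  assumes "0 < r" "r < (1::real)" shows "(\<lambda>n. real n powr b * r ^ n) \<longlonglongrightarrow> 0"
  using assms by real_asymp

text \<open>Compare \<open>A n\<close> with the average at \<open>s = a * n\<close>. For \<open>a
  < 1\<close> most of the weight sits at indices below \<open>n\<close>, where \<open>A\<close> is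
  larger, and for \<open>a > 1\<close> at indices above \<open>n\<close>, where \<open>A\<close>
  is smaller. This bounds the limit superior and inferior by \<open>C / D * a powr (-
  \<beta>)\<close>, and \<open>a\<close> can be taken arbitrarily close to
  \<open>1\<close>.\<close>

lemma squared_poisson_tauberian:
  fixes A :: "nat \<Rightarrow> real"
  assumes A: "decseq A" "\<And>n. 0 \<le> A n"
    and S: "((\<lambda>s. s powr (\<beta> + 1 / 2) * (\<Sum>k. squared_poisson s k * A k)) \<longlongrightarrow> C) at_top"
    and W: "((\<lambda>s. s powr (1 / 2) * (\<Sum>k. squared_poisson s k)) \<longlongrightarrow> D) at_top" and D: "0 < D"
  shows "(\<lambda>n. real n powr \<beta> * A n) \<longlonglongrightarrow> C / D"
proof -
  define S' where "S' s = (\<Sum>k. squared_poisson s k * A k)" for s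
  define W' where "W' s = (\<Sum>k. squared_poisson s k)" for s
  define err where "err a n = real n powr (\<beta> + 1 / 2) * (A 0 * (a * exp (1 - a)) ^ n)" for a n
  have to_top: "filterlim (\<lambda>n. a * real n) at_top sequentially" if "0 < a" for a
    using that by real_asymp
  have S_lim: "(\<lambda>n. real n powr (\<beta> + 1 / 2) * S' (a * real n)) \<longlonglongrightarrow> C / a powr (\<beta> + 1 / 2)"
    if "0 < a" for a
  proof -
    have "(\<lambda>n. ((a * real n) powr (\<beta> + 1 / 2) * S' (a * real n)) / a powr (\<beta> + 1 / 2))
        \<longlonglongrightarrow> C / a powr (\<beta> + 1 / 2)"
      using that unfolding S'_def by (intro tendsto_divide filterlim_compose[OF S to_top] tendsto_const) auto
    then show ?thesis using that by (simp add: powr_mult)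
  qed
  have W_lim: "(\<lambda>n. real n powr (1 / 2) * W' (a * real n)) \<longlonglongrightarrow> D / a powr (1 / 2)"
    if "0 < a" for a
  proof -
    have "(\<lambda>n. ((a * real n) powr (1 / 2) * W' (a * real n)) / a powr (1 / 2)) \<longlonglongrightarrow> D / a powr (1 / 2)"
      using that unfolding W'_def by (intro tendsto_divide filterlim_compose[OF W to_top] tendsto_const) auto
    then show ?thesis using that by (simp add: powr_mult)
  qed
  have err_lim: "err a \<longlonglongrightarrow> 0" if "0 < a" "a \<noteq> 1" for a
    using tendsto_mult_left[OF powr_times_geometric_tendsto_0[OF _ mult_exp_one_minus_less_one[OF that]], of "A 0" "\<beta> + 1 / 2"] that
    by (simp add: err_def[abs_def] mult_ac)
  have W_pos: "\<forall>\<^sub>F n in sequentially. 0 < real n powr (1 / 2) * W' (a * real n)" if "0 < a" for a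
    using order_tendstoD(1)[OF W_lim[OF that], of 0] that D by simp
  have limit_eq: "C / a powr (\<beta> + 1 / 2) / (D / a powr (1 / 2)) = C / D * a powr (- \<beta>)"
    if "0 < a" for a
  proof -
    have "a powr (\<beta> + 1 / 2) = a powr \<beta> * a powr (1 / 2)" by (rule powr_add)
    then show ?thesis using that D by (simp only:) (simp add: powr_minus divide_simps)
  qed
  have quotient: "(\<lambda>n. (real n powr (\<beta> + 1 / 2) * S' (a * real n) + c * err a n)
      / (real n powr (1 / 2) * W' (a * real n))) \<longlonglongrightarrow> C / D * a powr (- \<beta>)"
    if a: "0 < a" "a \<noteq> 1" for a c
  proof -
    have "(\<lambda>n. (real n powr (\<beta> + 1 / 2) * S' (a * real n) + c * err a n)
      / (real n powr (1 / 2) * W' (a * real n))) \<longlonglongrightarrow> (C / a powr (\<beta> + 1 / 2) + c * 0) / (D / a powr (1 / 2))"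
      using a D by (intro tendsto_intros S_lim W_lim err_lim) auto
    then show ?thesis using limit_eq[OF a(1)] by simp
  qed
  have product: "real n powr (\<beta> + 1 / 2) * (A n * w) = (real n powr \<beta> * A n) * (real n powr (1 / 2) * w)" for n w
    by (simp add: powr_add mult_ac)
  have near_one: "((\<lambda>a. C / D * a powr (- \<beta>)) \<longlongrightarrow> C / D) (at 1 within B)" for B
  proof -
    have "((\<lambda>a. C / D * a powr (- \<beta>)) \<longlongrightarrow> C / D * 1 powr (- \<beta>)) (at 1 within B)"
      by (intro tendsto_intros) auto
    then show ?thesis by simp
  qed
  show ?thesis
  proof (rule order_tendstoI)
    fix y assume y: "C / D < y"
    have "\<forall>\<^sub>F a in at_left 1. C / D * a powr (- \<beta>) < y \<and> 0 < a \<and> a < 1"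
      using eventually_conj[OF order_tendstoD(2)[OF near_one y] eventually_at_left_real[of 0 1]]
      by simp
    then obtain a where a: "C / D * a powr (- \<beta>) < y" "0 < a" "a < 1"
      using eventually_happens[of _ "at_left (1::real)"] by auto
    have "\<forall>\<^sub>F n in sequentially. (real n powr (\<beta> + 1 / 2) * S' (a * real n) + 1 * err a n)
      / (real n powr (1 / 2) * W' (a * real n)) < y"
      by (rule order_tendstoD(2)[OF quotient a(1)]) (use a in auto)
    then show "\<forall>\<^sub>F n in sequentially. real n powr \<beta> * A n < y"
      using W_pos[OF a(2)]
    proof eventually_elim
      case (elim n)
      have "real n powr (\<beta> + 1 / 2) * (A n * W' (a * real n))
         \<le> real n powr (\<beta> + 1 / 2) * (S' (a * real n) + A 0 * (a * exp (1 - a)) ^ n)"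
        using squared_poisson_average_lower[OF A a(2), of n] a(3)
        by (intro mult_left_mono) (auto simp: S'_def W'_def)
      then have "real n powr \<beta> * A n \<le> (real n powr (\<beta> + 1 / 2) * S' (a * real n) + 1 * err a n)
          / (real n powr (1 / 2) * W' (a * real n))"
        unfolding product pos_le_divide_eq[OF elim(2)] by (simp add: err_def distrib_left)
      then show ?case using elim(1) by linarith
    qed
  next
    fix y assume y: "y < C / D"
    have "\<forall>\<^sub>F a in at_right 1. y < C / D * a powr (- \<beta>) \<and> 1 < a"
      using eventually_conj[OF order_tendstoD(1)[OF near_one y] eventually_at_right_less[of 1]]
      by simp
    then obtain a where a: "y < C / D * a powr (- \<beta>)" "1 < a"
      using eventually_happens[of _ "at_right (1::real)"] by auto
    have "\<forall>\<^sub>F n in sequentially. y < (real n powr (\<beta> + 1 / 2) * S' (a * real n) + (- 1) * err a n)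
      / (real n powr (1 / 2) * W' (a * real n))"
      by (rule order_tendstoD(1)[OF quotient a(1)]) (use a in auto)
    moreover have "\<forall>\<^sub>F n in sequentially. 0 < real n powr (1 / 2) * W' (a * real n)"
      by (rule W_pos) (use a(2) in simp)
    ultimately show "\<forall>\<^sub>F n in sequentially. y < real n powr \<beta> * A n"
    proof eventually_elim
      case (elim n)
      have "real n powr (\<beta> + 1 / 2) * S' (a * real n)
         \<le> real n powr (\<beta> + 1 / 2) * (A n * W' (a * real n) + A 0 * (a * exp (1 - a)) ^ n)"
        using squared_poisson_average_upper[OF A, of a n] a(2)
        by (intro mult_left_mono) (auto simp: S'_def W'_def)
      then have "(real n powr (\<beta> + 1 / 2) * S' (a * real n) + (- 1) * err a n)
          / (real n powr (1 / 2) * W' (a * real n)) \<le> real n powr \<beta> * A n"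
        unfolding pos_divide_le_eq[OF elim(2)] product[symmetric] by (simp add: err_def distrib_left)
      then show ?case using elim(1) by linarith
    qed
  qed
qed

section \<open>Asymptotics of the averaged norms\<close>

lemma torus_fun_torus_gaussian: "torus_fun (torus_gaussian p s)"
  unfolding torus_fun_def
proof (intro allI)
  fix t :: "real ^ 'a" and j
  have "(sin (pi * (t + axis j 1) $ i))\<^sup>2 = (sin (pi * t $ i))\<^sup>2" for i
    by (simp add: axis_def distrib_left)
  then show "torus_gaussian p s (t + axis j 1) = torus_gaussian p s t"
    by (simp only: torus_gaussian_def)
qed

lemma continuous_on_average_symbol: "continuous_on S (average_symbol p \<theta>)"
  unfolding average_symbol_def by (intro continuous_intros continuous_on_component)

lemma cmod_average_symbol_le:
  assumes "\<And>j. 0 \<le> p $ j" "(\<Sum>j\<in>UNIV. p $ j) = 1"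
  shows "cmod (average_symbol p \<theta> t) \<le> 1"
proof -
  have "cmod (average_symbol p \<theta> t) \<le> (\<Sum>j\<in>UNIV. p $ j)"
    unfolding average_symbol_def by (rule sum_norm_le) (simp add: norm_mult assms(1))
  then show ?thesis by (simp add: assms(2))
qed

text \<open>Rotating the symbol by \<open>cis (2 * pi * u)\<close> is a translation along the diagonal. Since the
  weights sum to \<open>1\<close>, the identity \<open>1 - cos (2 * x) = 2 * (sin x)\<^sup>2\<close> can be applied to each term
  of the real part minus \<open>1\<close>.\<close>

lemma exp_average_symbol_eq_torus_gaussian:
  assumes "(\<Sum>j\<in>UNIV. p $ j) = 1"
  shows "exp (2 * s * (Re (average_symbol p \<theta> t * cis (2 * pi * u)) - 1))
    = torus_gaussian p s (t - \<theta> - u *\<^sub>R 1)"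
proof -
  have "Re (complex_of_real (p $ j) * cis (2 * pi * (\<theta> $ j - t $ j)) * cis (2 * pi * u))
      = p $ j - 2 * (p $ j * (sin (pi * (t - \<theta> - u *\<^sub>R 1) $ j))\<^sup>2)" for j
  proof -
    let ?x = "pi * (\<theta> $ j + u - t $ j)"
    have "2 * pi * (\<theta> $ j - t $ j) + 2 * pi * u = 2 * ?x" by (simp add: algebra_simps)
    then have "Re (complex_of_real (p $ j) * cis (2 * pi * (\<theta> $ j - t $ j)) * cis (2 * pi * u))
        = p $ j * cos (2 * ?x)"
      by (simp only: mult.assoc cis_mult) simp
    also have "\<dots> = p $ j - 2 * (p $ j * (sin ?x)\<^sup>2)"
      by (simp only: cos_double_sin) (simp add: algebra_simps)
    also have "sin ?x = - sin (pi * (t - \<theta> - u *\<^sub>R 1) $ j)"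
      by (simp add: sin_minus[symmetric] algebra_simps del: sin_minus)
    finally show ?thesis by simp
  qed
  then have "Re (average_symbol p \<theta> t * cis (2 * pi * u))
      = 1 - 2 * (\<Sum>j\<in>UNIV. p $ j * (sin (pi * (t - \<theta> - u *\<^sub>R 1) $ j))\<^sup>2)"
    unfolding average_symbol_def sum_distrib_right Re_sum
    by (simp add: sum_subtractf sum_distrib_left assms)
  then show ?thesis by (simp add: torus_gaussian_def)
qed

lemma continuous_on_diagonal_average:
  fixes \<phi> :: "real ^ 'd::finite \<Rightarrow> real"
  assumes "continuous_on UNIV \<phi>"
  shows "continuous_on S (\<lambda>x. integral (cbox 0 1) (\<lambda>u. \<phi> (x + \<theta> + u *\<^sub>R 1)))"
  by (rule integral_continuous_on_param)
    (auto simp: case_prod_beta intro!: continuous_on_compose2[OF assms] continuous_intros)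

text \<open>The sum over \<open>n\<close> is taken under the integral and becomes an average over
  diagonal translates of the kernel; after a change of the order of integration each translation
  is moved from the kernel to \<open>\<phi>\<close>. The cube is finally centred at the origin, so
  that the maximum of the kernel lies in its interior.\<close>

lemma squared_poisson_sums_symbol_powers:
  fixes \<phi> :: "real ^ 'd::finite \<Rightarrow> real"
  assumes \<phi>: "torus_fun \<phi>" "continuous_on UNIV \<phi>"
    and p: "\<And>j. 0 \<le> p $ j" "(\<Sum>j\<in>UNIV. p $ j) = 1" and s: "0 \<le> s"
  shows "(\<lambda>n. squared_poisson s n * integral (cbox 0 1) (\<lambda>t. \<phi> t * cmod (average_symbol p \<theta> t) ^ (2 * n)))
    sums integral (cbox (- (1 / 2) *\<^sub>R 1) ((1 / 2) *\<^sub>R 1))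
      (\<lambda>x. integral (cbox 0 1) (\<lambda>u. \<phi> (x + \<theta> + u *\<^sub>R 1)) * torus_gaussian p s x)"
proof -
  let ?m = "average_symbol p \<theta>" and ?G = "torus_gaussian p s"
  let ?I = "cbox 0 (1::real)" and ?Q = "cbox 0 (1::real ^ 'd)"
  let ?\<Phi> = "\<lambda>x. integral ?I (\<lambda>u. \<phi> (x + \<theta> + u *\<^sub>R 1))"
  have cont\<phi>: "continuous_on A (\<lambda>x. \<phi> (g x))" if "continuous_on A g"
    for A and g :: "'z::topological_space \<Rightarrow> real ^ 'd"
    by (rule continuous_on_compose2[OF \<phi>(2) that]) simp
  obtain B where B: "\<And>x. x \<in> ?Q \<Longrightarrow> \<bar>\<phi> x\<bar> \<le> B"
    using compact_imp_bounded[OF compact_continuous_image[OF continuous_on_subset[OF \<phi>(2) subset_UNIV] compact_cbox]]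
    unfolding bounded_iff by (metis imageI real_norm_def)
  have "(\<lambda>n. integral ?Q (\<lambda>t. \<phi> t * (squared_poisson s n * cmod (?m t) ^ (2 * n))))
      sums integral ?Q (\<lambda>t. \<Sum>n. \<phi> t * (squared_poisson s n * cmod (?m t) ^ (2 * n)))"
  proof (rule integral_sums)
    show "summable (\<lambda>n. B * squared_poisson s n)"
      by (intro summable_mult summable_squared_poisson s)
    show "continuous_on ?Q (\<lambda>t. \<phi> t * (squared_poisson s n * cmod (?m t) ^ (2 * n)))" for n
      by (intro continuous_intros cont\<phi> continuous_on_average_symbol)
    show "norm (\<phi> t * (squared_poisson s n * cmod (?m t) ^ (2 * n))) \<le> B * squared_poisson s n"
      if "t \<in> ?Q" for n t
    proof -
      have "cmod (?m t) ^ (2 * n) \<le> 1"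
        by (intro power_le_one cmod_average_symbol_le p) simp
      then have "squared_poisson s n * cmod (?m t) ^ (2 * n) \<le> squared_poisson s n"
        using mult_left_mono[OF _ squared_poisson_nonneg] by fastforce
      then show ?thesis
        unfolding real_norm_def abs_mult[of "\<phi> t"] using B[OF that]
        by (intro mult_mono) (auto simp: squared_poisson_nonneg abs_mult)
    qed
  qed
  also have "(\<lambda>n. integral ?Q (\<lambda>t. \<phi> t * (squared_poisson s n * cmod (?m t) ^ (2 * n))))
      = (\<lambda>n. squared_poisson s n * integral ?Q (\<lambda>t. \<phi> t * cmod (?m t) ^ (2 * n)))"
  proof
    fix n
    have "(\<lambda>t. \<phi> t * (squared_poisson s n * cmod (?m t) ^ (2 * n)))
        = (\<lambda>t. squared_poisson s n * (\<phi> t * cmod (?m t) ^ (2 * n)))"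
      by (simp add: fun_eq_iff mult_ac)
    then show "integral ?Q (\<lambda>t. \<phi> t * (squared_poisson s n * cmod (?m t) ^ (2 * n)))
        = squared_poisson s n * integral ?Q (\<lambda>t. \<phi> t * cmod (?m t) ^ (2 * n))"
      by (simp only: integral_mult_right)
  qed
  also have "(\<lambda>t. \<Sum>n. \<phi> t * (squared_poisson s n * cmod (?m t) ^ (2 * n)))
      = (\<lambda>t. integral ?I (\<lambda>u. \<phi> t * ?G (t - \<theta> - u *\<^sub>R 1)))"
  proof
    fix t
    show "(\<Sum>n. \<phi> t * (squared_poisson s n * cmod (?m t) ^ (2 * n)))
        = integral ?I (\<lambda>u. \<phi> t * ?G (t - \<theta> - u *\<^sub>R 1))"
      using sums_unique[OF sums_mult[OF squared_poisson_power_series[OF s, of "?m t"], of "\<phi> t"]]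
      unfolding exp_average_symbol_eq_torus_gaussian[OF p(2)] by (simp del: cbox_interval)
  qed
  also have "integral ?Q (\<lambda>t. integral ?I (\<lambda>u. \<phi> t * ?G (t - \<theta> - u *\<^sub>R 1)))
      = integral ?I (\<lambda>u. integral ?Q (\<lambda>t. \<phi> t * ?G (t - \<theta> - u *\<^sub>R 1)))"
    by (rule integral_swap_continuous) (auto simp: case_prod_beta intro!: continuous_intros cont\<phi>)
  also have "(\<lambda>u. integral ?Q (\<lambda>t. \<phi> t * ?G (t - \<theta> - u *\<^sub>R 1)))
      = (\<lambda>u. integral ?Q (\<lambda>t. \<phi> (t + \<theta> + u *\<^sub>R 1) * ?G t))"
  proof
    fix u
    have "torus_fun (\<lambda>t. \<phi> t * ?G (t - \<theta> - u *\<^sub>R 1))"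
      using \<phi>(1) torus_fun_translate[OF torus_fun_torus_gaussian[of p s], of "- \<theta> - u *\<^sub>R 1"]
      by (simp add: torus_fun_def algebra_simps)
    moreover have "continuous_on UNIV (\<lambda>t. \<phi> t * ?G (t - \<theta> - u *\<^sub>R 1))"
      by (intro continuous_intros cont\<phi>)
    ultimately show "integral ?Q (\<lambda>t. \<phi> t * ?G (t - \<theta> - u *\<^sub>R 1)) = integral ?Q (\<lambda>t. \<phi> (t + \<theta> + u *\<^sub>R 1) * ?G t)"
      using torus_integral_translate[of "\<lambda>t. \<phi> t * ?G (t - \<theta> - u *\<^sub>R 1)" "\<theta> + u *\<^sub>R 1"]
      by (simp add: add.assoc)
  qed
  also have "integral ?I (\<lambda>u. integral ?Q (\<lambda>t. \<phi> (t + \<theta> + u *\<^sub>R 1) * ?G t))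
      = integral ?Q (\<lambda>t. integral ?I (\<lambda>u. \<phi> (t + \<theta> + u *\<^sub>R 1) * ?G t))"
    by (rule integral_swap_continuous) (auto simp: case_prod_beta intro!: continuous_intros cont\<phi>)
  also have "(\<lambda>t. integral ?I (\<lambda>u. \<phi> (t + \<theta> + u *\<^sub>R 1) * ?G t)) = (\<lambda>t. ?\<Phi> t * ?G t)"
    by (simp del: cbox_interval)
  also have "integral ?Q (\<lambda>t. ?\<Phi> t * ?G t) = integral (cbox (- (1 / 2) *\<^sub>R 1) ((1 / 2) *\<^sub>R 1)) (\<lambda>t. ?\<Phi> t * ?G t)"
  proof -
    have "\<phi> (t + axis j 1 + \<theta> + u *\<^sub>R 1) = \<phi> (t + \<theta> + u *\<^sub>R 1)" for t j u
      using \<phi>(1)[unfolded torus_fun_def, rule_format, of "t + \<theta> + u *\<^sub>R 1" j]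
      by (simp add: algebra_simps)
    then have "torus_fun ?\<Phi>" by (simp add: torus_fun_def)
    then have "torus_fun (\<lambda>t. ?\<Phi> t * ?G t)"
      using torus_fun_torus_gaussian[of p s] by (simp add: torus_fun_def)
    moreover have "continuous_on UNIV (\<lambda>t. ?\<Phi> t * ?G t)"
      by (intro continuous_intros continuous_on_diagonal_average \<phi>)
    ultimately have "integral (cbox (- (1 / 2) *\<^sub>R 1) (- (1 / 2) *\<^sub>R 1 + 1)) (\<lambda>t. ?\<Phi> t * ?G t) = integral ?Q (\<lambda>t. ?\<Phi> t * ?G t)"
      by (rule torus_integral_cbox_translate)
    moreover have "- (1 / 2) *\<^sub>R 1 + 1 = ((1 / 2) *\<^sub>R 1 :: real ^ 'd)"
      by (simp add: vec_eq_iff)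
    ultimately show ?thesis by (simp only:)
  qed
  finally show ?thesis .
qed

lemma sqrt_prod: "sqrt (\<Prod>i\<in>I. f i) = (\<Prod>i\<in>I. sqrt (f i))"
  by (induction I rule: infinite_finite_induct) (auto simp: real_sqrt_mult)

lemma powr_half_eq_sqrt_power: "0 < s \<Longrightarrow> s powr (real n / 2) = sqrt s ^ n"
  using powr_powr[of s "1/2" "real n"] by (simp add: powr_half_sqrt powr_realpow)

lemma squared_poisson_symbol_powers_tendsto:
  fixes \<phi> :: "real ^ 'd::finite \<Rightarrow> real"
  assumes \<phi>: "torus_fun \<phi>" "continuous_on UNIV \<phi>"
    and p: "\<And>j. 0 < p $ j" "(\<Sum>j\<in>UNIV. p $ j) = 1"
  shows "((\<lambda>s. s powr (real CARD('d) / 2) *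
      (\<Sum>n. squared_poisson s n * integral (cbox 0 1) (\<lambda>t. \<phi> t * cmod (average_symbol p \<theta> t) ^ (2 * n))))
    \<longlongrightarrow> integral (cbox 0 1) (\<lambda>u. \<phi> (\<theta> + u *\<^sub>R 1)) / (\<Prod>j\<in>UNIV. sqrt (4 * pi * p $ j))) at_top"
proof -
  let ?\<Phi> = "\<lambda>x. integral (cbox 0 1) (\<lambda>u. \<phi> (x + \<theta> + u *\<^sub>R 1))"
  have "((\<lambda>s. sqrt s ^ CARD('d) * integral (cbox (- (1 / 2) *\<^sub>R 1) ((1 / 2) *\<^sub>R 1)) (\<lambda>x. ?\<Phi> x * torus_gaussian p s x))
     \<longlongrightarrow> ?\<Phi> 0 / (\<Prod>j\<in>UNIV. sqrt (4 * pi * p $ j))) at_top"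
    by (rule laplace_torus_gaussian[OF p(1) continuous_on_diagonal_average[OF \<phi>(2)]])
  moreover have "\<forall>\<^sub>F s in at_top. sqrt s ^ CARD('d) * integral (cbox (- (1 / 2) *\<^sub>R 1) ((1 / 2) *\<^sub>R 1)) (\<lambda>x. ?\<Phi> x * torus_gaussian p s x)
     = s powr (real CARD('d) / 2) *
      (\<Sum>n. squared_poisson s n * integral (cbox 0 1) (\<lambda>t. \<phi> t * cmod (average_symbol p \<theta> t) ^ (2 * n)))"
    using eventually_gt_at_top[of 0]
  proof eventually_elim
    case (elim s)
    show ?case
      using sums_unique[OF squared_poisson_sums_symbol_powers[OF \<phi> less_imp_le[OF p(1)] p(2) less_imp_le[OF elim], of \<theta>]] elim
      by (simp add: powr_half_eq_sqrt_power del: cbox_interval)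
  qed
  ultimately show ?thesis
    using Lim_transform_eventually by fastforce
qed

text \<open>In dimension one the symbol has modulus \<open>1\<close>, and the weighted sum of its
  powers is the total weight.\<close>

lemma squared_poisson_mass_tendsto:
  "((\<lambda>s. s powr (1 / 2) * (\<Sum>n. squared_poisson s n)) \<longlongrightarrow> 1 / sqrt (4 * pi)) at_top"
proof -
  have "cmod (average_symbol 1 (0 :: real ^ 1) t) = 1" for t
    by (simp add: average_symbol_def)
  moreover have "integral (cbox 0 (1 :: real ^ 1)) (\<lambda>_. 1 :: real) = 1"
    by (simp add: content_cbox_cart interval_eq_empty_cart)
  ultimately show ?thesis
    using squared_poisson_symbol_powers_tendsto[of "\<lambda>_. 1" "1 :: real ^ 1" 0]
    by (simp add: torus_fun_def)
qed

theorem proposition1p7: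
  fixes T :: "'d::finite \<Rightarrow> 'h \<Rightarrow> 'h::complex_hilbert_space"
    and p :: "real ^ 'd"
    and f :: 'h
    and \<phi> :: "real ^ 'd \<Rightarrow> real"
  assumes unitary: "\<And>j. unitary (T j)"
    and commute: "\<And>i j. T i \<circ> T j = T j \<circ> T i"
    and spectrum: "lebesgue_spectrum T"
    and p_pos: "\<And>j. p $ j > 0"
    and p_sum: "(\<Sum>j\<in>UNIV. p $ j) = 1"
    and density: "is_spectral_density T f \<phi>"
    and continuous: "continuous_on UNIV \<phi>"
  shows "\<forall>\<theta> :: real ^ 'd.
    (\<lambda>n. (4 * pi) powr ((real CARD('d) - 1) / 2) * sqrt (\<Prod>j\<in>UNIV. p $ j)
           * real n powr ((real CARD('d) - 1) / 2)
           * (norm ((twisted_average T p \<theta> ^^ n) f))\<^sup>2)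
      \<longlonglongrightarrow> (LINT u:{0..1}|lebesgue. \<phi> (\<chi> j. \<theta> $ j + u))"
proof
  fix \<theta> :: "real ^ 'd"
  define \<beta> where "\<beta> = (real CARD('d) - 1) / 2"
  define A where "A n = (norm ((twisted_average T p \<theta> ^^ n) f))\<^sup>2" for n
  have torus: "torus_fun \<phi>"
    and fourier: "\<And>l. (LINT t:cbox 0 1|lebesgue. complex_of_real (\<phi> t) * character l t)
       = cinner (lattice_power T l f) f"
    using density by (simp_all add: is_spectral_density_def character_def)
  have "((\<lambda>t. complex_of_real (\<phi> t) * character l t) has_integral cinner (lattice_power T l f) f) (cbox 0 1)" for l
  proof -
    have "continuous_on (cbox 0 1) (\<lambda>t. complex_of_real (\<phi> t) * character l t)"
      unfolding character_def
      by (intro continuous_intros continuous_on_component continuous_on_subset[OF continuous subset_UNIV])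
    from set_lebesgue_integral_eq_integral[OF absolutely_integrable_continuous[OF this]]
    show ?thesis by (simp add: fourier has_integral_iff)
  qed
  from integral_unique[OF twisted_average_power_norm_has_integral[where p = p and \<theta> = \<theta>, OF unitary commute this]]
  have A_eq: "A n = integral (cbox 0 1) (\<lambda>t. \<phi> t * cmod (average_symbol p \<theta> t) ^ (2 * n))" for n
    by (simp add: A_def)
  have "decseq A"
    unfolding A_def decseq_Suc_iff
    by (auto intro!: power_mono norm_twisted_average_le unitary p_sum less_imp_le[OF p_pos])
  moreover have "0 \<le> A n" for n by (simp add: A_def)
  moreover have "((\<lambda>s. s powr (\<beta> + 1 / 2) * (\<Sum>n. squared_poisson s n * A n))
      \<longlongrightarrow> integral (cbox 0 1) (\<lambda>u. \<phi> (\<theta> + u *\<^sub>R 1)) / (\<Prod>j\<in>UNIV. sqrt (4 * pi * p $ j))) at_top"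
    using squared_poisson_symbol_powers_tendsto[OF torus continuous p_pos p_sum, of \<theta>]
    unfolding A_eq by (simp add: \<beta>_def field_simps del: cbox_interval)
  ultimately have lim: "(\<lambda>n. real n powr \<beta> * A n) \<longlonglongrightarrow>
      integral (cbox 0 1) (\<lambda>u. \<phi> (\<theta> + u *\<^sub>R 1)) / (\<Prod>j\<in>UNIV. sqrt (4 * pi * p $ j)) / (1 / sqrt (4 * pi))"
    by (intro squared_poisson_tauberian squared_poisson_mass_tendsto) auto
  \<comment> \<open>The normalization in the theorem is the reciprocal of the constant in \<open>lim\<close>.\<close>
  have const: "(4 * pi) powr \<beta> * sqrt (\<Prod>j\<in>UNIV. p $ j) * (x / (\<Prod>j\<in>UNIV. sqrt (4 * pi * p $ j)) / (1 / sqrt (4 * pi))) = x" for x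
  proof -
    have "(4 * pi) powr \<beta> * sqrt (4 * pi) = (4 * pi) powr (real CARD('d) / 2)"
      by (simp add: powr_half_sqrt[symmetric] powr_add[symmetric] \<beta>_def field_simps)
    also have "\<dots> = (\<Prod>j\<in>(UNIV :: 'd set). sqrt (4 * pi))"
      by (subst powr_half_eq_sqrt_power) auto
    finally have "(\<Prod>j\<in>UNIV. sqrt (4 * pi * p $ j)) = (4 * pi) powr \<beta> * sqrt (4 * pi) * sqrt (\<Prod>j\<in>UNIV. p $ j)"
      by (simp only: real_sqrt_mult prod.distrib sqrt_prod)
    moreover have "0 < (\<Prod>j\<in>UNIV. p $ j)" by (intro prod_pos) (simp add: p_pos)
    ultimately show ?thesis by (simp add: less_imp_not_eq2[OF p_pos])
  qed
  have "continuous_on {0..1} (\<lambda>u. \<phi> (\<chi> j. \<theta> $ j + u))"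
    by (rule continuous_on_compose2[OF continuous]) (auto intro!: continuous_intros)
  then have "(LINT u:{0..1}|lebesgue. \<phi> (\<chi> j. \<theta> $ j + u)) = integral {0..1} (\<lambda>u. \<phi> (\<chi> j. \<theta> $ j + u))"
    by (intro set_lebesgue_integral_eq_integral(2) absolutely_integrable_continuous_real)
  moreover have "(\<lambda>u. \<phi> (\<chi> j. \<theta> $ j + u)) = (\<lambda>u. \<phi> (\<theta> + u *\<^sub>R 1))"
    by (intro ext arg_cong[of _ _ \<phi>]) (simp add: vec_eq_iff)
  ultimately have "(LINT u:{0..1}|lebesgue. \<phi> (\<chi> j. \<theta> $ j + u))
      = integral (cbox 0 1) (\<lambda>u. \<phi> (\<theta> + u *\<^sub>R 1))"
    by (simp only: cbox_interval)
  then show "(\<lambda>n. (4 * pi) powr ((real CARD('d) - 1) / 2) * sqrt (\<Prod>j\<in>UNIV. p $ j)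
           * real n powr ((real CARD('d) - 1) / 2) * (norm ((twisted_average T p \<theta> ^^ n) f))\<^sup>2)
      \<longlonglongrightarrow> (LINT u:{0..1}|lebesgue. \<phi> (\<chi> j. \<theta> $ j + u))"
    using tendsto_mult_left[OF lim, of "(4 * pi) powr \<beta> * sqrt (\<Prod>j\<in>UNIV. p $ j)"]
    unfolding const by (simp only: \<beta>_def A_def mult.assoc)
qed

end
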